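(* Let $a$ be an integer with $a>1$, and let $b=a+1$. Let $x,y\in\mathbb{Q}$ with $0\le x,y\le 1$. If $\mathcal{L}([\phi_{a,b}(G(x))])=\mathcal{L}([\phi_{a,b}(G(y))])$, then $x=y$.
   Context: For an irrational real number $\alpha$, its Lagrange constant is $\mathcal{L}(\alpha)=\limsup_{q\to\infty}\frac{1}{q\,\Vert q\alpha\Vert}$, where $q$ ranges over positive integers and $\Vert t\Vert$ denotes the distance from $t$ to the nearest integer. For a rational number $x$ with $0\le x\le 1$, $G(x)=G(x,1)G(x,2)G(x,3)\cdots$ is the right-infinite word over $\{0,1\}$ with letters $G(x,n)=\lfloor nx\rfloor-\lfloor (n-1)x\rfloor$. For positive integers $a,b$, $\phi_{a,b}$ is the substitution $0\mapsto aa$, $1\mapsto bb$, applied letter by letter to words over $\{0,1\}$ (the images being concatenated). For a right-infinite word $w=w_1w_2w_3\cdots$ of positive integers, $[w]=[0;w_1,w_2,w_3,\ldots]$ denotes the value of the regular continued fraction with these partial quotients. *)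

theory Defs
  imports "HOL-Analysis.Analysis" "HOL-Library.Stream"
begin

text \<open>
  The limit superior is taken in the extended reals, since it is infinite for some irrational
  \<open>\<alpha>\<close>. Only irrational \<open>\<alpha>\<close> are meaningful: otherwise the denominator vanishes infinitely often.
  The index \<open>q = 0\<close> does not influence the value.
\<close>

definition lagrange_const :: "real \<Rightarrow> ereal" where
  "lagrange_const \<alpha> = limsup (\<lambda>q::nat. ereal (1 / (real q * infdist (real q * \<alpha>) \<int>)))"

text \<open>
  Right-infinite words are streams. Stream positions start at \<open>0\<close> while the letters
  \<open>G(x,n)\<close> are numbered from \<open>n = 1\<close>, so \<open>G(x,n)\<close> is \<open>G_word x !! (n - 1)\<close>.
  For \<open>0 \<le> x \<le> 1\<close> all letters are \<open>0\<close> or \<open>1\<close>.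
\<close>

definition G_letter :: "real \<Rightarrow> nat \<Rightarrow> int" where
  "G_letter x n = \<lfloor>real n * x\<rfloor> - \<lfloor>(real n - 1) * x\<rfloor>"

definition G_word :: "real \<Rightarrow> int stream" where
  "G_word x = smap (G_letter x) (fromN 1)"

text \<open>The image of a letter other than \<open>0\<close> and \<open>1\<close> is irrelevant.\<close>

definition phi_letter :: "int \<Rightarrow> int \<Rightarrow> int \<Rightarrow> int list" where
  "phi_letter a b l = (if l = 0 then [a, a] else [b, b])"

definition phi :: "int \<Rightarrow> int \<Rightarrow> int stream \<Rightarrow> int stream" where
  "phi a b w = flat (smap (phi_letter a b) w)"

text \<open>\<open>cf_fin [w\<^sub>1, \<dots>, w\<^sub>n]\<close> is the finite continued fraction \<open>[0; w\<^sub>1, \<dots>, w\<^sub>n]\<close>.\<close>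

fun cf_fin :: "int list \<Rightarrow> real" where
  "cf_fin [] = 0"
| "cf_fin (w # ws) = 1 / (real_of_int w + cf_fin ws)"

text \<open>The limit exists whenever all partial quotients are positive.\<close>

definition cf_value :: "int stream \<Rightarrow> real" where
  "cf_value w = lim (\<lambda>n. cf_fin (stake n w))"

end

theory Submission
  imports Defs
begin

text \<open>
  Write \<open>A(t) = 1/(a + 1/(a + t))\<close> and \<open>B(t) = 1/(a + 1 + t)\<close>, and let
  \<open>s\<^sub>k = \<lfloor>(k+1)x\<rfloor> - \<lfloor>kx\<rfloor>\<close> for all integers \<open>k\<close>, so that \<open>s\<^sub>0 s\<^sub>1 \<dots>\<close> is the word \<open>G(x)\<close>.
  By Perron's formula the Lagrange constant of a continued fraction is the limit superior of the
  values \<open>w\<^sub>n + [0; w\<^sub>n\<^sub>+\<^sub>1, \<dots>] + [0; w\<^sub>n\<^sub>-\<^sub>1, \<dots>, w\<^sub>0]\<close> (lemmas \<open>lagrange_const_le\<close>,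
  \<open>lagrange_const_ge\<close>). In a doubled word over \<open>a < b = a + 1\<close> the large values occur where a
  block \<open>bb\<close> meets a block \<open>aa\<close>; there the value is \<open>b + A(u) + B(v)\<close>, where \<open>u\<close> is the value of
  the doubled word read on beyond \<open>aa\<close> and \<open>v\<close> that of the doubled word read on beyond \<open>bb\<close> in
  the opposite direction. The word \<open>s\<close> is balanced, which makes the corner \<open>s\<^sub>-\<^sub>1 s\<^sub>0 = 1 0\<close> best
  for both summands simultaneously, and for rational \<open>x\<close> this corner recurs periodically. Hence
  for \<open>0 < x < 1\<close> the Lagrange constant is \<open>b + A(U) + B(V)\<close>, with \<open>U\<close> and \<open>V\<close> the values of the
  doubled words \<open>s\<^sub>1 s\<^sub>2 \<dots>\<close> and \<open>s\<^sub>-\<^sub>2 s\<^sub>-\<^sub>3 \<dots>\<close> (lemma \<open>lagrange_const_G_word\<close>).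

  For \<open>a \<ge> 2\<close> the function \<open>A\<close> is much flatter than \<open>B\<close>: a change of \<open>v\<close> outweighs a change of
  \<open>u\<close> of comparable size. The constant is nevertheless not monotone in \<open>x\<close>. Given \<open>x < y\<close> in the
  open unit interval, let \<open>p/q\<close> be the fraction of least denominator in \<open>[x, y]\<close>. No integer lies
  in \<open>[kx, ky]\<close> for \<open>0 < k < q\<close>, so the four words that define \<open>U\<close> and \<open>V\<close> for \<open>x\<close> and \<open>y\<close> agree
  in their first \<open>q - 2\<close> letters. Their next letters are \<open>0, 0\<close> on the left of \<open>p/q\<close>, \<open>1, 1\<close> on
  its right, and \<open>1\<close> (for \<open>U\<close>), \<open>0\<close> (for \<open>V\<close>) at \<open>p/q\<close> itself. A common prefix acts on the tails
  by a Moebius map of small distortion, so the next letters decide. If \<open>p/q < y\<close>, then \<open>V\<close> drops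
  from \<open>x\<close> to \<open>y\<close> by more than half of the drop of \<open>U\<close>, which is enough since \<open>B\<close> is more than
  twice as steep as \<open>A\<close>, and the constant of \<open>x\<close> is the smaller one.
  If \<open>p/q = y\<close>, then \<open>U\<close> drops at that letter while \<open>V\<close> changes only later, and the constant
  of \<open>x\<close> is the larger one. Thus the constants are ordered like the preorder traversal of the
  Stern-Brocot tree (lemma \<open>mechanical_corner_distinct\<close>). The end points \<open>0\<close> and \<open>1\<close> give
  constants below those of all interior points.
\<close>

section \<open>Continued fractions with partial quotients at least two\<close>

lemma cf_fin_bounds:
  assumes "\<forall>w\<in>set ws. c \<le> w" "1 \<le> c"
  shows "0 \<le> cf_fin ws" "cf_fin ws \<le> 1 / real_of_int c"
proof -
  have "0 \<le> cf_fin ws \<and> cf_fin ws \<le> 1 / real_of_int c"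
    using assms
  proof (induction ws)
    case (Cons w ws)
    then have "0 \<le> cf_fin ws" "c \<le> w" by auto
    then show ?case using Cons.prems by (auto intro!: divide_left_mono mult_pos_pos add_pos_nonneg)
  qed auto
  then show "0 \<le> cf_fin ws" "cf_fin ws \<le> 1 / real_of_int c" by auto
qed

text \<open>The map \<open>t \<mapsto> 1/(w + t)\<close> contracts the nonnegative reals by the factor \<open>1/w\<^sup>2 \<le> 1/4\<close>, so
  every common partial quotient gains a factor \<open>1/4\<close>. This explicit rate replaces the usual
  estimate by denominators.\<close>

lemma cf_fin_common_prefix:
  assumes "\<forall>w\<in>set (xs @ ys @ zs). 2 \<le> w"
  shows "\<bar>cf_fin (xs @ ys) - cf_fin (xs @ zs)\<bar> \<le> (1/4) ^ length xs"
  using assms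
proof (induction xs)
  case Nil
  then have "\<forall>w\<in>set ys. 2 \<le> w" "\<forall>w\<in>set zs. 2 \<le> w" by auto
  from cf_fin_bounds[OF this(1)] cf_fin_bounds[OF this(2)] show ?case by auto
next
  case (Cons w xs)
  define s where "s = cf_fin (xs @ ys)"
  define t where "t = cf_fin (xs @ zs)"
  have "\<forall>w\<in>set (xs @ ys). 2 \<le> w" "\<forall>w\<in>set (xs @ zs). 2 \<le> w" using Cons.prems by auto
  from cf_fin_bounds[OF this(1)] cf_fin_bounds[OF this(2)]
  have st: "0 \<le> s" "0 \<le> t" unfolding s_def t_def by auto
  have w: "2 \<le> real_of_int w" using Cons.prems by simp
  have "(real_of_int w + s) * (real_of_int w + t) \<ge> 2 * 2"
    using st w by (intro mult_mono) auto
  moreover have "1 / (real_of_int w + s) - 1 / (real_of_int w + t)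
      = (t - s) / ((real_of_int w + s) * (real_of_int w + t))"
    using st w by (simp add: field_simps)
  ultimately have "\<bar>1 / (real_of_int w + s) - 1 / (real_of_int w + t)\<bar> \<le> \<bar>t - s\<bar> / 4"
    using divide_left_mono[of 4 "(real_of_int w + s) * (real_of_int w + t)" "\<bar>t - s\<bar>"] st w
    by (simp add: abs_mult)
  also have "\<bar>t - s\<bar> \<le> (1/4) ^ length xs"
    using Cons unfolding s_def t_def by (auto simp: abs_minus_commute)
  finally show ?case by (simp add: s_def t_def)
qed

text \<open>Indexing partial quotients by a function instead of a stream makes shifts and reversed words
  plain lambda terms.\<close>

definition cf_lim :: "(nat \<Rightarrow> int) \<Rightarrow> real" where
  "cf_lim f = lim (\<lambda>n. cf_fin (map f [0..<n]))"

lemma cf_value_eq_cf_lim: "cf_value w = cf_lim (snth w)"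
proof -
  have "stake n w = map (snth w) [0..<n]" for n
    by (rule nth_equalityI) auto
  then show ?thesis unfolding cf_value_def cf_lim_def by simp
qed

lemma cf_fin_truncation:
  assumes "\<And>i. 2 \<le> f i" "n \<le> m"
  shows "\<bar>cf_fin (map f [0..<m]) - cf_fin (map f [0..<n])\<bar> \<le> (1/4) ^ n"
proof -
  have "map f [0..<m] = map f [0..<n] @ map f [n..<m]"
    using assms(2) by (metis le_add_diff_inverse map_append upt_add_eq_append zero_le)
  then show ?thesis
    using cf_fin_common_prefix[of "map f [0..<n]" "map f [n..<m]" "[]"] assms(1) by auto
qed

lemma cf_lim_tendsto:
  assumes "\<And>i. 2 \<le> f i"
  shows "(\<lambda>n. cf_fin (map f [0..<n])) \<longlonglongrightarrow> cf_lim f"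
proof -
  have "Cauchy (\<lambda>n. cf_fin (map f [0..<n]))"
  proof (rule metric_CauchyI)
    fix e :: real assume "0 < e"
    then obtain N where N: "(1/4 :: real) ^ N < e / 2"
      using real_arch_pow_inv[of "e/2" "1/4"] by auto
    have "\<bar>cf_fin (map f [0..<m]) - cf_fin (map f [0..<N])\<bar> < e / 2" if "m \<ge> N" for m
      using cf_fin_truncation[of f, OF assms that] N by simp
    then have "dist (cf_fin (map f [0..<m])) (cf_fin (map f [0..<n])) < e"
      if "m \<ge> N" "n \<ge> N" for m n
      using that unfolding dist_real_def by (smt (verit) field_sum_of_halves)
    then show "\<exists>M. \<forall>m\<ge>M. \<forall>n\<ge>M. dist (cf_fin (map f [0..<m])) (cf_fin (map f [0..<n])) < e"
      by blast
  qed
  then show ?thesis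
    unfolding cf_lim_def by (simp add: Cauchy_convergent_iff convergent_LIMSEQ_iff)
qed

lemma cf_lim_approx:
  assumes "\<And>i. 2 \<le> f i"
  shows "\<bar>cf_lim f - cf_fin (map f [0..<n])\<bar> \<le> (1/4) ^ n"
proof (rule LIMSEQ_le_const2)
  show "(\<lambda>m. \<bar>cf_fin (map f [0..<m]) - cf_fin (map f [0..<n])\<bar>)
      \<longlonglongrightarrow> \<bar>cf_lim f - cf_fin (map f [0..<n])\<bar>"
    by (intro tendsto_intros cf_lim_tendsto assms)
  show "\<exists>N. \<forall>m\<ge>N. \<bar>cf_fin (map f [0..<m]) - cf_fin (map f [0..<n])\<bar> \<le> (1/4) ^ n"
    using cf_fin_truncation[of f, OF assms] by blast
qed

lemma cf_lim_bounds:
  assumes "\<And>i. c \<le> f i" "2 \<le> c"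
  shows "0 \<le> cf_lim f" "cf_lim f \<le> 1 / real_of_int c"
proof -
  have f: "\<And>i. 2 \<le> f i" using assms order_trans by blast
  have *: "\<forall>w\<in>set (map f [0..<n]). c \<le> w" for n using assms by auto
  show "0 \<le> cf_lim f"
    by (rule LIMSEQ_le_const[OF cf_lim_tendsto[of f, OF f]])
      (use cf_fin_bounds(1)[OF *] assms in auto)
  show "cf_lim f \<le> 1 / real_of_int c"
    by (rule LIMSEQ_le_const2[OF cf_lim_tendsto[of f, OF f]])
      (use cf_fin_bounds(2)[OF *] assms in auto)
qed

lemma cf_lim_unfold:
  assumes "\<And>i. 2 \<le> f i"
  shows "cf_lim f = 1 / (real_of_int (f 0) + cf_lim (\<lambda>i. f (Suc i)))"
proof -
  have "map f [0..<Suc n] = f 0 # map (\<lambda>i. f (Suc i)) [0..<n]" for n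
    by (simp add: upt_conv_Cons map_Suc_upt[symmetric] comp_def del: upt_Suc)
  then have "(\<lambda>n. 1 / (real_of_int (f 0) + cf_fin (map (\<lambda>i. f (Suc i)) [0..<n])))
      \<longlonglongrightarrow> cf_lim f"
    using LIMSEQ_Suc[OF cf_lim_tendsto[of f, OF assms]] by simp
  moreover have "real_of_int (f 0) + cf_lim (\<lambda>i. f (Suc i)) \<noteq> 0"
    using cf_lim_bounds(1)[of 2 "\<lambda>i. f (Suc i)", OF assms] assms[of 0] by linarith
  then have "(\<lambda>n. 1 / (real_of_int (f 0) + cf_fin (map (\<lambda>i. f (Suc i)) [0..<n])))
      \<longlonglongrightarrow> 1 / (real_of_int (f 0) + cf_lim (\<lambda>i. f (Suc i)))"
    by (intro tendsto_intros cf_lim_tendsto assms)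
  ultimately show ?thesis using LIMSEQ_unique by blast
qed

lemma cf_lim_pos:
  assumes "\<And>i. 2 \<le> f i"
  shows "0 < cf_lim f"
proof -
  have "0 \<le> cf_lim (\<lambda>i. f (Suc i))" by (rule cf_lim_bounds(1)[of 2]) (use assms in auto)
  then show ?thesis
    unfolding cf_lim_unfold[of f, OF assms] using assms[of 0] by (intro divide_pos_pos) auto
qed

section \<open>Best approximation and the limit superior\<close>

lemma abs_le_abs_add:
  fixes x y :: real
  assumes "0 \<le> x * y"
  shows "\<bar>x\<bar> \<le> \<bar>x + y\<bar>"
  using assms unfolding zero_le_mult_iff by linarith

text \<open>The recursion starts one step early: \<open>cf_den w (n + 1)\<close> and \<open>cf_num w (n + 1)\<close> belong to the
  convergent \<open>[0; w\<^sub>0, \<dots>, w\<^sub>n\<^sub>-\<^sub>1]\<close>, and index \<open>0\<close> is the formal convergent \<open>1/0\<close>.\<close>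

fun cf_den :: "(nat \<Rightarrow> int) \<Rightarrow> nat \<Rightarrow> int" where
  "cf_den w 0 = 0"
| "cf_den w (Suc 0) = 1"
| "cf_den w (Suc (Suc n)) = w n * cf_den w (Suc n) + cf_den w n"

fun cf_num :: "(nat \<Rightarrow> int) \<Rightarrow> nat \<Rightarrow> int" where
  "cf_num w 0 = 1"
| "cf_num w (Suc 0) = 0"
| "cf_num w (Suc (Suc n)) = w n * cf_num w (Suc n) + cf_num w n"

definition cf_err :: "(nat \<Rightarrow> int) \<Rightarrow> nat \<Rightarrow> real" where
  "cf_err w n = cf_den w n * cf_lim w - cf_num w n"

lemma cf_det: "cf_den w (Suc n) * cf_num w n - cf_den w n * cf_num w (Suc n) = (-1) ^ n"
  by (induction n) (auto simp: algebra_simps)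

context
  fixes w :: "nat \<Rightarrow> int"
  assumes w: "\<And>i. 2 \<le> w i"
begin

lemma cf_den_growth: "0 \<le> cf_den w n \<and> cf_den w n < cf_den w (Suc n)"
proof (induction n)
  case (Suc n)
  have "2 * cf_den w (Suc n) \<le> w n * cf_den w (Suc n)"
    using w[of n] Suc by (intro mult_right_mono) auto
  with Suc show ?case unfolding cf_den.simps by linarith
qed auto

lemma cf_den_pos: "0 < cf_den w (Suc n)"
  using cf_den_growth[of n] by linarith

lemma cf_den_ge: "int n \<le> cf_den w n"
proof (induction n)
  case (Suc n)
  then show ?case using cf_den_growth[of n] by simp
qed auto

text \<open>Up to sign, the ratios of consecutive errors are the complete tails; in particular the
  errors alternate in sign and never vanish.\<close>

lemma cf_err_Suc: "cf_err w (Suc n) = - cf_lim (\<lambda>i. w (n + i)) * cf_err w n"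
proof (induction n)
  case 0
  then show ?case by (simp add: cf_err_def)
next
  case (Suc n)
  let ?t = "cf_lim (\<lambda>i. w (n + i))" and ?t' = "cf_lim (\<lambda>i. w (Suc n + i))"
  have pos: "0 < ?t" "0 < ?t'" using w by (auto intro!: cf_lim_pos)
  have "?t = 1 / (w n + ?t')"
    using cf_lim_unfold[of "\<lambda>i. w (n + i)"] w by simp
  moreover have "0 < w n + ?t'" using pos w[of n] by (auto intro!: add_pos_pos)
  ultimately have t: "?t * (w n + ?t') = 1" by (simp add: field_simps)
  have "cf_err w (Suc (Suc n)) = w n * cf_err w (Suc n) + cf_err w n"
    by (simp add: cf_err_def algebra_simps)
  also have "cf_err w n = - (?t * (w n + ?t')) * - cf_err w n" using t by simp
  also have "\<dots> = - (w n + ?t') * cf_err w (Suc n)" unfolding Suc by (simp add: algebra_simps)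
  finally show ?case by (simp add: algebra_simps)
qed

lemma cf_err_sign: "0 < (-1) ^ Suc n * cf_err w n"
proof (induction n)
  case 0 show ?case by (simp add: cf_err_def)
next
  case (Suc n)
  have "0 < cf_lim (\<lambda>i. w (n + i))" using w by (auto intro!: cf_lim_pos)
  from mult_pos_pos[OF this Suc] show ?case unfolding cf_err_Suc by (simp add: algebra_simps)
qed

lemma cf_err_nonzero: "cf_err w n \<noteq> 0"
  using cf_err_sign[of n] by auto

text \<open>Consecutive convergents form a lattice basis, so \<open>(q, p)\<close> is an integer combination \<open>i, j\<close> of
  them. For \<open>q\<close> below the later denominator \<open>i\<close> is nonzero and \<open>i\<close>, \<open>j\<close> do not have the same
  sign; since the two errors have opposite signs, nothing cancels in the error of \<open>q\<close>.\<close>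

lemma cf_best_approximation:
  fixes q p :: int
  assumes "0 < q" "q < cf_den w (Suc (Suc n))"
  shows "\<bar>cf_err w (Suc n)\<bar> \<le> \<bar>q * cf_lim w - p\<bar>"
proof -
  let ?Q = "cf_den w (Suc n)" and ?Q' = "cf_den w (Suc (Suc n))"
  let ?P = "cf_num w (Suc n)" and ?P' = "cf_num w (Suc (Suc n))"
  define e :: int where "e = (-1) ^ Suc n"
  have e: "e * e = 1" unfolding e_def by (simp add: power_mult_distrib[symmetric])
  have det: "?Q' * ?P - ?Q * ?P' = e" unfolding e_def by (rule cf_det)
  \<comment> \<open>Coordinates by Cramer's rule; the determinant is \<open>e = \<plusminus>1\<close>.\<close>
  define i where "i = e * (?Q' * p - q * ?P')"
  define j where "j = e * (q * ?P - ?Q * p)"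
  have "i * ?Q + j * ?Q' = e * (q * (?Q' * ?P - ?Q * ?P'))"
    unfolding i_def j_def by (simp add: algebra_simps)
  then have q: "q = i * ?Q + j * ?Q'" using det e by (simp add: algebra_simps)
  have "i * ?P + j * ?P' = e * (p * (?Q' * ?P - ?Q * ?P'))"
    unfolding i_def j_def by (simp add: algebra_simps)
  then have p: "p = i * ?P + j * ?P'" using det e by (simp add: algebra_simps)
  have Q: "0 < ?Q" "0 < ?Q'" by (rule cf_den_pos)+
  have ij: "i \<noteq> 0 \<and> i * j \<le> 0"
  proof (rule ccontr)
    assume "\<not> (i \<noteq> 0 \<and> i * j \<le> 0)"
    then consider "i \<ge> 0" "j > 0" | "i \<le> 0" "j \<le> 0"
      by (cases "i = 0"; cases "j > 0") (auto simp: not_le zero_less_mult_iff)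
    then show False
    proof cases
      case 1
      then have "0 \<le> i * ?Q" "1 * ?Q' \<le> j * ?Q'" using Q by (auto intro!: mult_right_mono)
      then show False using q assms by linarith
    next
      case 2
      then have "i * ?Q \<le> 0" "j * ?Q' \<le> 0" using Q by (auto intro!: mult_nonpos_nonneg)
      then show False using q assms by linarith
    qed
  qed
  let ?E = "cf_err w (Suc n)" and ?E' = "cf_err w (Suc (Suc n))"
  have opp: "?E * ?E' \<le> 0"
    using cf_err_sign[of "Suc n"] cf_err_sign[of "Suc (Suc n)"]
    by (cases "even n") (auto simp: mult_le_0_iff)
  have eq: "q * cf_lim w - p = i * ?E + j * ?E'"
    unfolding cf_err_def by (subst q, subst p) (simp only: of_int_add of_int_mult algebra_simps)
  have same: "0 \<le> (i * ?E) * (j * ?E')"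
  proof -
    have "0 \<le> real_of_int (- (i * j)) * (- (?E * ?E'))"
      using ij opp by (intro mult_nonneg_nonneg) (simp_all del: of_int_minus of_int_mult)
    then show ?thesis by (simp add: algebra_simps)
  qed
  have "\<bar>?E\<bar> \<le> \<bar>real_of_int i\<bar> * \<bar>?E\<bar>"
    using ij by (intro mult_le_cancel_right1[THEN iffD2]) auto
  also have "\<dots> = \<bar>i * ?E\<bar>" by (simp add: abs_mult)
  also have "\<dots> \<le> \<bar>i * ?E + j * ?E'\<bar>"
    using same by (rule abs_le_abs_add)
  finally show ?thesis unfolding eq .
qed

lemma infdist_Ints_ge:
  fixes q :: int
  assumes "0 < q" "q < cf_den w (Suc (Suc n))"
  shows "\<bar>cf_err w (Suc n)\<bar> \<le> infdist (q * cf_lim w) \<int>"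
proof -
  have "\<bar>cf_err w (Suc n)\<bar> \<le> (INF z\<in>\<int>. dist (q * cf_lim w) z)"
    using cf_best_approximation[OF assms]
    by (intro cINF_greatest) (auto simp: dist_real_def elim!: Ints_cases)
  moreover have "(\<int> :: real set) \<noteq> {}" using Ints_0 by blast
  ultimately show ?thesis by (simp only: infdist_notempty[of "\<int> :: real set"] not_False_eq_True if_False simp_thms)
qed

lemma infdist_Ints_den:
  "infdist (cf_den w (Suc n) * cf_lim w) \<int> = \<bar>cf_err w (Suc n)\<bar>"
proof (rule antisym)
  have "infdist (cf_den w (Suc n) * cf_lim w) \<int> \<le> dist (cf_den w (Suc n) * cf_lim w) (cf_num w (Suc n))"
    by (rule infdist_le) auto
  then show "infdist (cf_den w (Suc n) * cf_lim w) \<int> \<le> \<bar>cf_err w (Suc n)\<bar>"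
    by (simp add: dist_real_def cf_err_def)
  show "\<bar>cf_err w (Suc n)\<bar> \<le> infdist (cf_den w (Suc n) * cf_lim w) \<int>"
    by (intro infdist_Ints_ge cf_den_pos cf_den_growth[THEN conjunct2])
qed

text \<open>The part of the word already read enters the error reversed: this is the left half of the
  two-sided value.\<close>

lemma cf_den_ratio:
  "cf_den w n / cf_den w (Suc n) = cf_fin (rev (map w [0..<n]))"
proof (induction n)
  case (Suc n)
  have "0 < cf_den w (Suc n)" by (rule cf_den_pos)
  then have "1 / (w n + cf_den w n / cf_den w (Suc n))
      = cf_den w (Suc n) / (w n * cf_den w (Suc n) + cf_den w n)"
    by (simp add: add_divide_distrib[symmetric] field_simps)
  then show ?case using Suc by simp
qed auto

text \<open>Divide the determinant identity, which equals \<open>1\<close> in absolute value, by the product of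
  denominator and error.\<close>

lemma cf_err_value:
  "1 / (cf_den w (Suc n) * \<bar>cf_err w (Suc n)\<bar>)
     = w n + cf_lim (\<lambda>i. w (Suc n + i)) + cf_fin (rev (map w [0..<n]))"
proof -
  let ?t = "cf_lim (\<lambda>i. w (n + i))" and ?t' = "cf_lim (\<lambda>i. w (Suc n + i))"
  define Q where "Q = real_of_int (cf_den w n)"
  define Q' where "Q' = real_of_int (cf_den w (Suc n))"
  define E where "E = \<bar>cf_err w n\<bar>"
  have Q': "0 < Q'" unfolding Q'_def using cf_den_pos by simp
  have E: "0 < E" unfolding E_def using cf_err_nonzero by simp
  have t: "0 < ?t" using w by (auto intro!: cf_lim_pos)
  have E': "\<bar>cf_err w (Suc n)\<bar> = ?t * E"
    unfolding cf_err_Suc E_def using t by (simp add: abs_mult)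
  have "(-1) ^ Suc n * cf_err w n = E"
    using cf_err_sign[of n] unfolding E_def by (cases "even n") auto
  then have En: "cf_err w n = (-1) ^ Suc n * E" by (cases "even n") auto
  have "Q' * cf_err w n - Q * cf_err w (Suc n)
      = - real_of_int (cf_den w (Suc n) * cf_num w n - cf_den w n * cf_num w (Suc n))"
    unfolding cf_err_def Q_def Q'_def by (simp add: algebra_simps)
  also have "\<dots> = (-1) ^ Suc n" unfolding cf_det by simp
  finally have "(-1) ^ Suc n * (Q' * E + Q * ?t * E) = (-1) ^ Suc n"
    unfolding cf_err_Suc En by (simp add: algebra_simps)
  then have one: "Q' * E + Q * ?t * E = 1" by (cases "even n") auto
  have "1 / (Q' * (?t * E)) = (Q' * E + Q * ?t * E) / (Q' * (?t * E))" using one by simp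
  also have "\<dots> = 1 / ?t + Q / Q'" using Q' t E by (simp add: field_simps)
  also have "1 / ?t = w n + ?t'"
    using cf_lim_unfold[of "\<lambda>i. w (n + i)"] w by simp
  finally show ?thesis unfolding E' cf_den_ratio[of n, symmetric] Q_def Q'_def .
qed

end

text \<open>The partial quotients are extended to all integers, so that both halves are infinite continued
  fractions and periodic words have periodic values.\<close>

definition two_sided_value :: "(int \<Rightarrow> int) \<Rightarrow> int \<Rightarrow> real" where
  "two_sided_value z n = z n + cf_lim (\<lambda>i. z (n + 1 + int i)) + cf_lim (\<lambda>i. z (n - 1 - int i))"

lemma two_sided_value_approx:
  assumes z: "\<And>i. 2 \<le> z i"
  defines "w \<equiv> \<lambda>i. z (int i)"
  shows "\<bar>1 / (cf_den w (Suc n) * \<bar>cf_err w (Suc n)\<bar>) - two_sided_value z n\<bar> \<le> (1/4) ^ n"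
proof -
  have w: "\<And>i. 2 \<le> w i" unfolding w_def using z .
  have "rev (map w [0..<n]) = map (\<lambda>i. z (int n - 1 - int i)) [0..<n]"
    by (rule nth_equalityI) (auto simp: w_def rev_nth of_nat_diff algebra_simps)
  moreover have "(\<lambda>i. w (Suc n + i)) = (\<lambda>i. z (int n + 1 + int i))"
    unfolding w_def by (auto simp: algebra_simps)
  ultimately show ?thesis
    unfolding cf_err_value[of w, OF w] two_sided_value_def
    using cf_lim_approx[of "\<lambda>i. z (int n - 1 - int i)" n] z
    by (simp add: w_def abs_minus_commute)
qed

text \<open>Between consecutive denominators the smaller one gives the best \<open>q \<parallel>q \<alpha>\<parallel>\<close>, both factors being
  minimal there; so only convergents matter for the limit superior.\<close>

lemma lagrange_const_le:
  assumes z: "\<And>i. 2 \<le> z i" and le: "\<And>n. two_sided_value z n \<le> L"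
  shows "lagrange_const (cf_lim (\<lambda>i. z (int i))) \<le> ereal L"
proof -
  define w where "w = (\<lambda>i::nat. z (int i))"
  have w: "\<And>i. 2 \<le> w i" unfolding w_def using z .
  have "eventually (\<lambda>q. ereal (1 / (real q * infdist (real q * cf_lim w) \<int>)) \<le> ereal (L + e)) sequentially"
    if e: "0 < e" for e
  proof -
    obtain N where N: "(1/4 :: real) ^ N < e"
      using real_arch_pow_inv[of e "1/4"] e by auto
    have "1 / (real q * infdist (real q * cf_lim w) \<int>) \<le> L + e"
      if q: "int q \<ge> cf_den w (Suc N)" for q :: nat
    proof -
      \<comment> \<open>Locate \<open>q\<close> between two consecutive denominators.\<close>
      define m where "m = (LEAST m. int q < cf_den w m)"
      have "int q < cf_den w (Suc q)" using cf_den_ge[of w "Suc q", OF w] by simp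
      then have m: "int q < cf_den w m" and mle: "\<And>k. k < m \<Longrightarrow> cf_den w k \<le> int q"
        unfolding m_def by (auto intro: LeastI dest: not_less_Least)
      have mono: "cf_den w i \<le> cf_den w j" if "i \<le> j" for i j
        using cf_den_growth[of w, OF w] by (intro lift_Suc_mono_le[OF _ that] less_imp_le) blast
      have "Suc N < m" using m q mono[of m "Suc N"] by (meson le_less_trans not_le not_less_iff_gr_or_eq order.trans)
      then obtain n where n: "m = Suc (Suc n)" "N \<le> n" by (auto dest!: less_imp_Suc_add)
      have lo: "cf_den w (Suc n) \<le> int q" using mle n by simp
      have den: "0 < cf_den w (Suc n)" by (rule cf_den_pos[of w, OF w])
      have E: "0 < \<bar>cf_err w (Suc n)\<bar>" using cf_err_nonzero[of w, OF w] by simp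
      have "\<bar>cf_err w (Suc n)\<bar> \<le> infdist (int q * cf_lim w) \<int>"
        using m n lo den by (intro infdist_Ints_ge[of w, OF w]) auto
      then have "cf_den w (Suc n) * \<bar>cf_err w (Suc n)\<bar> \<le> real q * infdist (real q * cf_lim w) \<int>"
        using lo den by (intro mult_mono) auto
      moreover have "0 < cf_den w (Suc n) * \<bar>cf_err w (Suc n)\<bar>" using den E by simp
      ultimately have "1 / (real q * infdist (real q * cf_lim w) \<int>)
          \<le> 1 / (cf_den w (Suc n) * \<bar>cf_err w (Suc n)\<bar>)"
        by (intro frac_le) auto
      also have "\<dots> \<le> two_sided_value z n + (1/4) ^ n"
        using two_sided_value_approx[of z n, OF z] unfolding w_def abs_le_iff by linarith
      also have "(1/4 :: real) ^ n \<le> (1/4) ^ N" using n by (intro power_decreasing) auto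
      finally show ?thesis using le[of n] N by simp
    qed
    then show ?thesis
      unfolding eventually_sequentially
      by (intro exI[of _ "nat (cf_den w (Suc N))"]) auto
  qed
  then have "lagrange_const (cf_lim w) \<le> ereal (L + e)" if "0 < e" for e
    unfolding lagrange_const_def using that by (intro Limsup_bounded) auto
  then show ?thesis
    unfolding w_def using ereal_le_epsilon2[of "lagrange_const (cf_lim (\<lambda>i. z (int i)))" "ereal L"] by simp
qed

lemma lagrange_const_ge:
  assumes z: "\<And>i. 2 \<le> z i" and ge: "\<And>N. \<exists>n\<ge>N. L \<le> two_sided_value z (int n)"
  shows "ereal L \<le> lagrange_const (cf_lim (\<lambda>i. z (int i)))"
proof -
  define w where "w = (\<lambda>i::nat. z (int i))"
  have w: "\<And>i. 2 \<le> w i" unfolding w_def using z .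
  let ?g = "\<lambda>q::nat. ereal (1 / (real q * infdist (real q * cf_lim w) \<int>))"
  have freq: "\<exists>q\<ge>M. ereal (L - e) \<le> ?g q" if e: "0 < e" for e M
  proof -
    obtain N where N: "(1/4 :: real) ^ N < e"
      using real_arch_pow_inv[of e "1/4"] e by auto
    obtain n where n: "n \<ge> max M N" "L \<le> two_sided_value z (int n)" using ge by blast
    define q where "q = nat (cf_den w (Suc n))"
    have den: "0 < cf_den w (Suc n)" by (rule cf_den_pos[of w, OF w])
    then have q: "real q = cf_den w (Suc n)" "q \<ge> M"
      using cf_den_ge[of w "Suc n", OF w] n unfolding q_def by auto
    have "(1/4 :: real) ^ n \<le> (1/4) ^ N" using n by (intro power_decreasing) auto
    then have "L - e \<le> two_sided_value z n - (1/4) ^ n" using n N by linarith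
    also have "\<dots> \<le> 1 / (real q * infdist (real q * cf_lim w) \<int>)"
      unfolding q infdist_Ints_den[of w, OF w]
      using two_sided_value_approx[of z n, OF z] unfolding w_def abs_le_iff by linarith
    finally show ?thesis using q by auto
  qed
  have below: "ereal (L - e) \<le> lagrange_const (cf_lim w)" if e: "0 < e" for e
    unfolding lagrange_const_def
  proof (rule Limsup_greatest)
    fix P :: "nat \<Rightarrow> bool" assume "eventually P sequentially"
    then obtain M where "\<And>q. q \<ge> M \<Longrightarrow> P q" by (auto simp: eventually_sequentially)
    then obtain q where "P q" "ereal (L - e) \<le> ?g q" using freq[OF e, of M] by blast
    then show "ereal (L - e) \<le> (SUP q\<in>Collect P. ?g q)" by (intro SUP_upper2[of q]) auto
  qed
  have "ereal L \<le> lagrange_const (cf_lim w)"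
  proof (cases "lagrange_const (cf_lim w)")
    case (real r)
    then have "L \<le> r + e" if "0 < e" for e using below[OF that] by simp
    then show ?thesis using real by (simp add: field_le_epsilon)
  next
    case MInf
    then show ?thesis using below[of 1] by simp
  qed simp
  then show ?thesis unfolding w_def .
qed

section \<open>Doubled words and their Moebius maps\<close>

definition letter :: "int \<Rightarrow> int \<Rightarrow> int" where
  "letter a l = (if l = 0 then a else a + 1)"

definition doubled_cf :: "int \<Rightarrow> (nat \<Rightarrow> int) \<Rightarrow> real" where
  "doubled_cf a f = cf_lim (\<lambda>i. letter a (f (i div 2)))"

text \<open>The effect of one doubled letter \<open>c c\<close> in front of a continued fraction with value \<open>t\<close>. An even
  number of partial quotients makes the map increasing.\<close>

definition pair_map :: "real \<Rightarrow> real \<Rightarrow> real" where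
  "pair_map c t = 1 / (c + 1 / (c + t))"

lemma pair_map_eq:
  assumes "1 \<le> c" "0 \<le> t"
  shows "pair_map c t = (c + t) / (c\<^sup>2 + 1 + c * t)"
proof -
  have "c + t \<noteq> 0" using assms by linarith
  then have "c + 1 / (c + t) = (c\<^sup>2 + 1 + c * t) / (c + t)"
    by (simp add: field_simps power2_eq_square)
  then show ?thesis unfolding pair_map_def by simp
qed

lemma pair_map_denom_pos:
  fixes c t :: real
  assumes "1 \<le> c" "0 \<le> t"
  shows "0 < c\<^sup>2 + 1 + c * t"
  using assms by (intro add_pos_nonneg) auto

lemma pair_map_diff:
  assumes "1 \<le> c" "0 \<le> s" "0 \<le> t"
  shows "pair_map c s - pair_map c t = (s - t) / ((c\<^sup>2 + 1 + c * s) * (c\<^sup>2 + 1 + c * t))"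
proof -
  have nz: "c\<^sup>2 + 1 + c * s \<noteq> 0" "c\<^sup>2 + 1 + c * t \<noteq> 0"
    using pair_map_denom_pos[of c s] pair_map_denom_pos[of c t] assms by auto
  show ?thesis
    unfolding pair_map_eq[OF assms(1,2)] pair_map_eq[OF assms(1,3)] diff_frac_eq[OF nz]
    by (rule arg_cong2[where f = "(/)"]) (simp_all add: algebra_simps power2_eq_square)
qed

lemma pair_map_mono:
  assumes "1 \<le> c" "0 \<le> s" "s \<le> t"
  shows "pair_map c s \<le> pair_map c t"
proof -
  have "0 \<le> pair_map c t - pair_map c s"
    unfolding pair_map_diff[OF assms(1) order_trans[OF assms(2,3)] assms(2)]
    using pair_map_denom_pos[of c s] pair_map_denom_pos[of c t] assms
    by (intro divide_nonneg_pos mult_pos_pos) auto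
  then show ?thesis by simp
qed

lemma pair_map_nonneg: "1 \<le> c \<Longrightarrow> 0 \<le> t \<Longrightarrow> 0 \<le> pair_map c t"
  by (simp add: pair_map_def)

text \<open>For a Moebius map \<open>W(t) = (m + m't)/(d + d't)\<close> with \<open>m'd - md' = 1\<close>, differences of values are
  \<open>(s - t)/((d + d's)(d + d't))\<close>. Here \<open>K = 1/d\<^sup>2\<close> and \<open>r = d'/d \<le> 1\<close>: up to the common scale \<open>K\<close>
  the distortion is governed by one parameter in the unit interval, whatever the prefix.\<close>

lemma foldr_pair_map_moebius:
  assumes "\<forall>c\<in>set cs. 1 \<le> c"
  shows "\<exists>K r. 0 < K \<and> 0 \<le> r \<and> r \<le> 1 \<and> (\<forall>s t. 0 \<le> s \<longrightarrow> 0 \<le> t \<longrightarrow>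
    foldr pair_map cs s - foldr pair_map cs t = K * (s - t) / ((1 + r * s) * (1 + r * t)))"
  using assms
proof (induction cs rule: rev_induct)
  case Nil
  show ?case by (rule exI[of _ 1], rule exI[of _ 0]) simp
next
  case (snoc c cs)
  then obtain K r where K: "0 < K" "0 \<le> r" "r \<le> 1"
    and eq: "\<And>s t. 0 \<le> s \<Longrightarrow> 0 \<le> t \<Longrightarrow> foldr pair_map cs s - foldr pair_map cs t
        = K * (s - t) / ((1 + r * s) * (1 + r * t))" by auto
  have c: "1 \<le> c" using snoc.prems by simp
  \<comment> \<open>The constant coefficient of the new denominator, in units of the old one.\<close>
  define q where "q = c\<^sup>2 + 1 + r * c"
  have rc: "0 \<le> r * c" using c K by simp
  have q: "0 < q" unfolding q_def using rc c by (intro add_pos_nonneg) auto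
  have "c \<le> c\<^sup>2" using c by (simp add: power2_eq_square)
  then have q': "c + r \<le> q" unfolding q_def using rc K by linarith
  have fac: "1 + r * pair_map c s = q * (1 + (c + r) / q * s) / (c\<^sup>2 + 1 + c * s)" if "0 \<le> s" for s
  proof -
    let ?N = "c\<^sup>2 + 1 + c * s"
    have "1 + r * (x / N) = (N + r * x) / N" if "0 < N" for x N :: real
      using that by (simp add: add_divide_distrib)
    then have "1 + r * pair_map c s = (?N + r * (c + s)) / ?N"
      using pair_map_denom_pos[OF c that] unfolding pair_map_eq[OF c that] .
    also have "?N + r * (c + s) = q * (1 + (c + r) / q * s)"
      using q by (simp add: distrib_left) (simp add: q_def algebra_simps)
    finally show ?thesis .
  qed
  show ?case
  proof (rule exI[of _ "K / q\<^sup>2"], rule exI[of _ "(c + r) / q"], intro conjI allI impI)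
    fix s t :: real assume s: "0 \<le> s" and t: "0 \<le> t"
    let ?Ns = "c\<^sup>2 + 1 + c * s" and ?Nt = "c\<^sup>2 + 1 + c * t"
    let ?fs = "1 + (c + r) / q * s" and ?ft = "1 + (c + r) / q * t"
    have N: "0 < ?Ns" "0 < ?Nt" using pair_map_denom_pos c s t by auto
    have f: "0 < ?fs" "0 < ?ft" using c K q s t by (auto intro!: add_pos_nonneg mult_nonneg_nonneg divide_nonneg_pos)
    have "foldr pair_map (cs @ [c]) s - foldr pair_map (cs @ [c]) t
        = K * (pair_map c s - pair_map c t) / ((1 + r * pair_map c s) * (1 + r * pair_map c t))"
      using eq[of "pair_map c s" "pair_map c t"] pair_map_nonneg c s t by simp
    also have "\<dots> = K * ((s - t) / (?Ns * ?Nt)) / (q * ?fs / ?Ns * (q * ?ft / ?Nt))"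
      unfolding fac[OF s] fac[OF t] pair_map_diff[OF c s t] ..
    also have "\<dots> = K / q\<^sup>2 * (s - t) / (?fs * ?ft)"
    proof -
      have *: "K * (d / (n * m)) / (q * u / n * (q * v / m)) = K / q\<^sup>2 * d / (u * v)"
        if "0 < n" "0 < m" for d n m u v :: real
        using that by (simp add: power2_eq_square)
      show ?thesis by (rule *[OF N])
    qed
    finally show "foldr pair_map (cs @ [c]) s - foldr pair_map (cs @ [c]) t
        = K / q\<^sup>2 * (s - t) / (?fs * ?ft)" .
  qed (use K q q' c in auto)
qed

lemma frac_le_frac_iff:
  fixes x y z w :: real
  assumes "0 < y" "0 < w"
  shows "x / y \<le> z / w \<longleftrightarrow> x * w \<le> z * y"
  using assms by (simp add: field_simps)

lemma frac_less_frac_iff: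
  fixes x y z w :: real
  assumes "0 < y" "0 < w"
  shows "x / y < z / w \<longleftrightarrow> x * w < z * y"
  using assms by (simp add: field_simps)

text \<open>The left side bounds the values of doubled words starting with a nonzero letter from above, the
  right side those of doubled words starting with zero from below: the two ranges are disjoint.\<close>

lemma digit_gap_pos:
  fixes A :: real
  assumes "2 \<le> A"
  shows "(A + 2) / (A\<^sup>2 + 3 * A + 3) < A / (A\<^sup>2 + 1)"
proof -
  have "0 < A\<^sup>2" using assms by simp
  then have pos: "0 < A\<^sup>2 + 3 * A + 3" "0 < A\<^sup>2 + 1" using assms by linarith+
  have "2 < A\<^sup>2 + 2 * A" using assms \<open>0 < A\<^sup>2\<close> by linarith
  then have "(A + 2) * (A\<^sup>2 + 1) < A * (A\<^sup>2 + 3 * A + 3)"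
    by (simp add: algebra_simps power2_eq_square)
  then show ?thesis by (intro frac_less_frac_iff[OF pos, THEN iffD2])
qed

context
  fixes a :: int
  assumes a: "2 \<le> a"
begin

lemma letter_ge: "a \<le> letter a l" "2 \<le> letter a l"
  using a by (auto simp: letter_def)

lemma doubled_cf_bounds: "0 \<le> doubled_cf a f" "doubled_cf a f \<le> 1 / a"
  unfolding doubled_cf_def
  by (rule cf_lim_bounds[of a]; use letter_ge a in blast)+

lemma doubled_cf_tail:
  "cf_lim (\<lambda>i. letter a (f (Suc i div 2))) = 1 / (letter a (f 0) + doubled_cf a (\<lambda>i. f (Suc i)))"
  using cf_lim_unfold[of "\<lambda>i. letter a (f (Suc i div 2))"] letter_ge
  by (simp add: doubled_cf_def)

lemma doubled_cf_unfold:
  "doubled_cf a f = pair_map (letter a (f 0)) (doubled_cf a (\<lambda>i. f (Suc i)))"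
  using cf_lim_unfold[of "\<lambda>i. letter a (f (i div 2))"] letter_ge
  by (simp add: doubled_cf_def[of a f] pair_map_def doubled_cf_tail)

lemma doubled_cf_prefix:
  "doubled_cf a f
     = foldr pair_map (map (\<lambda>i. real_of_int (letter a (f i))) [0..<k]) (doubled_cf a (\<lambda>i. f (i + k)))"
proof (induction k)
  case (Suc k)
  then show ?case using doubled_cf_unfold[of "\<lambda>i. f (i + k)"] by simp
qed simp

lemma doubled_cf_pair_map_bounds:
  "pair_map (letter a (f 0)) 0 \<le> doubled_cf a f"
  "doubled_cf a f \<le> pair_map (letter a (f 0)) (1 / a)"
  unfolding doubled_cf_unfold[of f]
  using letter_ge[of "f 0"] doubled_cf_bounds a by (auto intro!: pair_map_mono)

lemma doubled_cf_zero_bounds: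
  assumes "f 0 = 0"
  shows "a / (a\<^sup>2 + 1) \<le> doubled_cf a f" "doubled_cf a f \<le> (a\<^sup>2 + 1) / (a * (a\<^sup>2 + 2))"
proof -
  have "pair_map a (1 / a) = (a + 1 / a) / (real_of_int (a\<^sup>2 + 2))"
    using a by (subst pair_map_eq) auto
  also have "\<dots> = (a\<^sup>2 + 1) / (a * (a\<^sup>2 + 2))"
    using a by (simp add: field_simps power2_eq_square)
  finally show "doubled_cf a f \<le> (a\<^sup>2 + 1) / (a * (a\<^sup>2 + 2))"
    using doubled_cf_pair_map_bounds(2)[of f] assms by (simp add: letter_def)
  show "a / (a\<^sup>2 + 1) \<le> doubled_cf a f"
    using doubled_cf_pair_map_bounds(1)[of f] assms a by (simp add: letter_def pair_map_eq)
qed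

text \<open>In the upper bound the tail is estimated by \<open>1\<close> rather than \<open>1/a\<close>: the expression becomes simpler
  and the range stays short enough.\<close>

lemma doubled_cf_nonzero_bounds:
  assumes "f 0 \<noteq> 0"
  shows "(a + 1) / (a\<^sup>2 + 2 * a + 2) \<le> doubled_cf a f"
    "doubled_cf a f \<le> (a + 2) / (a\<^sup>2 + 3 * a + 3)"
proof -
  have l: "letter a (f 0) = a + 1" using assms by (simp add: letter_def)
  have "pair_map (a + 1) (1 / a) \<le> pair_map (a + 1) 1"
    using a by (intro pair_map_mono) auto
  also have "\<dots> = (a + 2) / (a\<^sup>2 + 3 * a + 3)"
    using a by (simp add: pair_map_eq power2_eq_square algebra_simps)
  finally show "doubled_cf a f \<le> (a + 2) / (a\<^sup>2 + 3 * a + 3)"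
    using doubled_cf_pair_map_bounds(2)[of f] l by simp
  have "pair_map (a + 1) 0 = (a + 1) / (a\<^sup>2 + 2 * a + 2)"
    using a by (simp add: pair_map_eq power2_eq_square algebra_simps)
  then show "(a + 1) / (a\<^sup>2 + 2 * a + 2) \<le> doubled_cf a f"
    using doubled_cf_pair_map_bounds(1)[of f] l by simp
qed

lemma doubled_cf_common_prefix:
  assumes eq: "\<And>i. i < k \<Longrightarrow> f i = h i"
  shows "doubled_cf a f
     = foldr pair_map (map (\<lambda>i. real_of_int (letter a (h i))) [0..<k]) (doubled_cf a (\<lambda>i. f (i + k)))"
proof -
  have "map (\<lambda>i. real_of_int (letter a (f i))) [0..<k] = map (\<lambda>i. real_of_int (letter a (h i))) [0..<k]"
    using eq by simp
  then show ?thesis using doubled_cf_prefix[of f k] by (simp only:)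
qed

lemma prefix_moebius:
  fixes h :: "nat \<Rightarrow> int" and k :: nat
  defines "W \<equiv> foldr pair_map (map (\<lambda>i. real_of_int (letter a (h i))) [0..<k])"
  obtains K r where "0 < K" "0 \<le> r" "r \<le> 1"
    "\<And>s t. 0 \<le> s \<Longrightarrow> 0 \<le> t \<Longrightarrow> W s - W t = K * (s - t) / ((1 + r * s) * (1 + r * t))"
proof -
  have "\<forall>c\<in>set (map (\<lambda>i. real_of_int (letter a (h i))) [0..<k]). 1 \<le> c"
    using letter_ge(2) by (auto intro: order_trans[of 1 2])
  from foldr_pair_map_moebius[OF this] that show thesis unfolding W_def by blast
qed

text \<open>A doubled letter occupies two positions, so the first difference is always felt with the same
  sign and the alternating order of continued fractions becomes the lexicographic one.\<close>

lemma doubled_cf_lex_less: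
  assumes eq: "\<And>i. i < n \<Longrightarrow> f i = g i" and fn: "f n = 0" and gn: "g n \<noteq> 0"
  shows "doubled_cf a g < doubled_cf a f"
proof -
  let ?W = "foldr pair_map (map (\<lambda>i. real_of_int (letter a (f i))) [0..<n])"
  let ?s = "doubled_cf a (\<lambda>i. f (i + n))" and ?t = "doubled_cf a (\<lambda>i. g (i + n))"
  obtain K r where Kr: "0 < K" "0 \<le> r" "r \<le> 1"
    "\<And>s t. 0 \<le> s \<Longrightarrow> 0 \<le> t \<Longrightarrow> ?W s - ?W t = K * (s - t) / ((1 + r * s) * (1 + r * t))"
    using prefix_moebius[of f n] by metis
  have st: "0 \<le> ?s" "0 \<le> ?t" by (rule doubled_cf_bounds)+
  have lt: "?t < ?s"
    using doubled_cf_zero_bounds(1)[of "\<lambda>i. f (i + n)"] doubled_cf_nonzero_bounds(2)[of "\<lambda>i. g (i + n)"]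
      digit_gap_pos[of a] a fn gn by simp
  have "0 < K * (?s - ?t) / ((1 + r * ?s) * (1 + r * ?t))"
    using Kr lt st by (intro divide_pos_pos mult_pos_pos add_pos_nonneg) auto
  then have "0 < ?W ?s - ?W ?t" using Kr(4)[OF st] by simp
  moreover have "doubled_cf a g = ?W ?t" by (rule doubled_cf_common_prefix) (use eq in auto)
  moreover have "doubled_cf a f = ?W ?s" by (rule doubled_cf_prefix)
  ultimately show ?thesis by simp
qed

text \<open>For binary words, domination of all prefix sums forces the lexicographic comparison at the first
  difference.\<close>

lemma doubled_cf_antimono_sums:
  assumes f: "\<And>i. f i \<in> {0, 1}" and g: "\<And>i. g i \<in> {0, 1}"
    and le: "\<And>n. sum f {..<n} \<le> sum g {..<n}"
  shows "doubled_cf a g \<le> doubled_cf a f"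
proof (cases "f = g")
  case False
  then have ex: "\<exists>i. f i \<noteq> g i" by auto
  define n where "n = (LEAST i. f i \<noteq> g i)"
  have n: "f n \<noteq> g n" unfolding n_def using ex by (rule LeastI_ex)
  have eq: "f i = g i" if "i < n" for i using not_less_Least[of i] that unfolding n_def by blast
  have "f n \<le> g n" using le[of "Suc n"] eq by simp
  then have "f n = 0" "g n \<noteq> 0" using n f[of n] g[of n] by auto
  then show ?thesis using doubled_cf_lex_less[of n f g] eq by simp
qed simp

end

section \<open>Estimates at a corner\<close>

text \<open>The value at the last letter of a block \<open>bb\<close> followed by \<open>aa\<close>, less \<open>b\<close>: \<open>u\<close> is the value of
  what follows \<open>aa\<close>, and \<open>v\<close> the value of what precedes \<open>bb\<close>, read backwards.\<close>

definition corner_value :: "int \<Rightarrow> real \<Rightarrow> real \<Rightarrow> real" where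
  "corner_value a u v = pair_map a u + 1 / (real_of_int a + 1 + v)"

text \<open>Polynomial inequalities for \<open>A \<ge> 2\<close> are proved below by expanding in \<open>c = A - 2\<close>, where all
  coefficients turn out to be nonnegative.\<close>

lemma nonneg_poly_shift:
  fixes A :: real
  assumes "2 \<le> A"
  obtains c where "0 \<le> c" "A = 2 + c"
  using assms by (metis add.commute diff_add_cancel diff_ge_0_iff_ge)

text \<open>The slope of \<open>pair_map A\<close> is at most \<open>1/(A\<^sup>2 + 1)\<^sup>2\<close>, that of \<open>1/(A + 1 + t)\<close> for \<open>t \<le> 1/A\<close>
  at least \<open>1/(A + 1 + 1/A)\<^sup>2\<close> in absolute value. Their ratio is at least
  \<open>(10/7)\<^sup>2 > 2\<close>, attained at \<open>A = 2\<close>, so a drop of \<open>v\<close> wins as soon as the drop of \<open>u\<close> is less than twice as large.\<close>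

lemma corner_right_dominates:
  fixes A u u' v v' :: real
  assumes A: "2 \<le> A" and u: "0 \<le> u" "0 \<le> u'" and v: "0 \<le> v'" "v' < v" "v \<le> 1 / A"
    and gap: "u - u' < 2 * (v - v')"
  shows "pair_map A u - pair_map A u' < 1 / (A + 1 + v') - 1 / (A + 1 + v)"
proof (cases "u \<le> u'")
  case True
  then have "pair_map A u \<le> pair_map A u'" using A u by (intro pair_map_mono) auto
  moreover have "1 / (A + 1 + v) < 1 / (A + 1 + v')"
    using A v by (intro divide_strict_left_mono mult_pos_pos) auto
  ultimately show ?thesis by linarith
next
  case False
  note vv = v(2)
  have num: "2 * (A + 1 + 1 / A)\<^sup>2 \<le> (A\<^sup>2 + 1)\<^sup>2"
  proof -
    obtain c where c: "0 \<le> c" "A = 2 + c" using A by (rule nonneg_poly_shift)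
    have "(A * (A\<^sup>2 + 1))\<^sup>2 - 2 * (A * (A + 1) + 1)\<^sup>2
        = c^6 + 12*c^5 + 60*c^4 + 156*c^3 + 211*c^2 + 120*c + 2"
      unfolding c(2) by algebra
    then have "2 * (A * (A + 1) + 1)\<^sup>2 \<le> (A * (A\<^sup>2 + 1))\<^sup>2" using c by (simp add: algebra_simps)
    moreover have "A * (A + 1) + 1 = A * (A + 1 + 1 / A)" using A by (simp add: field_simps)
    ultimately have "A\<^sup>2 * (2 * (A + 1 + 1 / A)\<^sup>2) \<le> A\<^sup>2 * (A\<^sup>2 + 1)\<^sup>2"
      by (simp only: power_mult_distrib mult.left_commute mult.assoc)
    then show ?thesis using A by simp
  qed
  have pos: "0 < A + 1 + 1 / A" using A by (simp add: add_pos_pos)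
  have "pair_map A u - pair_map A u' = (u - u') / ((A\<^sup>2 + 1 + A * u) * (A\<^sup>2 + 1 + A * u'))"
    using A u by (intro pair_map_diff) auto
  also have "\<dots> \<le> (u - u') / ((A\<^sup>2 + 1) * (A\<^sup>2 + 1))"
    using A u False by (intro divide_left_mono mult_mono mult_pos_pos add_pos_nonneg) auto
  also have "\<dots> < 2 * (v - v') / ((A\<^sup>2 + 1) * (A\<^sup>2 + 1))"
    using gap by (intro divide_strict_right_mono) (auto intro!: mult_pos_pos add_nonneg_pos)
  also have "\<dots> = 2 * (v - v') / (A\<^sup>2 + 1)\<^sup>2" by (simp add: power2_eq_square)
  also have "\<dots> \<le> 2 * (v - v') / (2 * (A + 1 + 1 / A)\<^sup>2)"
    using num vv pos A by (intro divide_left_mono) (auto intro!: mult_pos_pos add_nonneg_pos)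
  also have "\<dots> = (v - v') / ((A + 1 + 1 / A) * (A + 1 + 1 / A))"
    unfolding power2_eq_square by (rule mult_divide_mult_cancel_left) simp
  also have "\<dots> \<le> (v - v') / ((A + 1 + v') * (A + 1 + v))"
    using A v vv by (intro divide_left_mono mult_mono mult_pos_pos add_pos_nonneg) auto
  also have "\<dots> = 1 / (A + 1 + v') - 1 / (A + 1 + v)"
    using A v vv by (simp add: diff_frac_eq)
  finally show ?thesis .
qed

text \<open>Here the slopes are compared the other way round: that of \<open>pair_map A\<close> is at least
  \<open>1/(A\<^sup>2 + 2)\<^sup>2\<close> on \<open>[0, 1/A]\<close>, the other one at most \<open>1/(A + 1)\<^sup>2\<close>, so \<open>u\<close> prevails only if \<open>v\<close> changes much less.\<close>

lemma corner_left_dominates: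
  fixes A u u' v v' :: real
  assumes A: "2 \<le> A" and u: "0 \<le> u'" "u' < u" "u \<le> 1 / A" and v: "0 \<le> v" "0 \<le> v'"
    and gap: "(v' - v) * (A\<^sup>2 + 2)\<^sup>2 < (u - u') * (A + 1)\<^sup>2"
  shows "1 / (A + 1 + v) - 1 / (A + 1 + v') < pair_map A u - pair_map A u'"
proof (cases "v \<le> v'")
  case True
  have "1 / (A + 1 + v) - 1 / (A + 1 + v') = (v' - v) / ((A + 1 + v) * (A + 1 + v'))"
    using A v by (simp add: diff_frac_eq)
  also have "\<dots> \<le> (v' - v) / ((A + 1) * (A + 1))"
    using A v True by (intro divide_left_mono mult_mono mult_pos_pos) auto
  also have "\<dots> < (u - u') / ((A\<^sup>2 + 2) * (A\<^sup>2 + 2))"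
    using gap A by (subst frac_less_frac_iff) (auto simp: power2_eq_square intro!: mult_pos_pos add_nonneg_pos)
  also have "\<dots> \<le> (u - u') / ((A\<^sup>2 + 1 + A * u) * (A\<^sup>2 + 1 + A * u'))"
  proof -
    have "A * u \<le> 1" using u A by (simp add: field_simps)
    moreover from this have "A * u' \<le> 1" using mult_left_mono[of u' u A] u A by linarith
    ultimately show ?thesis
      using A u by (intro divide_left_mono mult_mono mult_pos_pos add_pos_nonneg) auto
  qed
  also have "\<dots> = pair_map A u - pair_map A u'"
    using A u by (intro pair_map_diff[symmetric]) auto
  finally show ?thesis .
next
  case False
  then have "1 / (A + 1 + v) \<le> 1 / (A + 1 + v')" using A v by (intro frac_le) auto
  moreover have "0 < (u - u') / ((A\<^sup>2 + 1 + A * u) * (A\<^sup>2 + 1 + A * u'))"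
    using A u by (intro divide_pos_pos mult_pos_pos add_pos_nonneg) auto
  then have "0 < pair_map A u - pair_map A u'"
    using A u by (subst pair_map_diff) auto
  ultimately show ?thesis by linarith
qed


lemma moebius_denominator_ratio:
  fixes r s t d :: real
  assumes "0 \<le> r" "r \<le> 1" "0 \<le> t" "s \<le> t + d" "0 \<le> d"
  shows "1 + r * s \<le> (1 + d) * (1 + r * t)"
proof -
  have "r * s \<le> r * t + r * d" using mult_left_mono[OF assms(4,1)] by (simp add: algebra_simps)
  moreover have "r * d \<le> 1 * d" using assms by (intro mult_right_mono)
  moreover have "0 \<le> d * (r * t)" using assms by simp
  ultimately show ?thesis by (simp add: algebra_simps)
qed

lemma zero_range_width:
  fixes A :: real
  assumes "2 \<le> A"
  shows "(A\<^sup>2 + 1) / (A * (A\<^sup>2 + 2)) - A / (A\<^sup>2 + 1) = 1 / (A * (A\<^sup>2 + 2) * (A\<^sup>2 + 1))"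
proof -
  have nz: "A * (A\<^sup>2 + 2) \<noteq> 0" "A\<^sup>2 + 1 \<noteq> 0" using assms by (auto simp: add_nonneg_eq_0_iff)
  show ?thesis unfolding diff_frac_eq[OF nz]
    by (rule arg_cong2[where f = "(/)"]) (auto simp: algebra_simps power2_eq_square)
qed

lemma zero_range_width_le:
  fixes A :: real
  assumes "2 \<le> A"
  shows "(A\<^sup>2 + 1) / (A * (A\<^sup>2 + 2)) \<le> A / (A\<^sup>2 + 1) + 1 / 60"
proof -
  have "2 * 2 \<le> A * A" using assms by (intro mult_mono) auto
  then have "2 * (2 * 2 + 2) * (2 * 2 + 1) \<le> A * (A\<^sup>2 + 2) * (A\<^sup>2 + 1)"
    using assms unfolding power2_eq_square by (intro mult_mono add_mono) auto
  then have "1 / (A * (A\<^sup>2 + 2) * (A\<^sup>2 + 1)) \<le> 1 / 60" by (intro frac_le) auto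
  then show ?thesis using zero_range_width[OF assms] by linarith
qed

lemma nonzero_range_width_le:
  fixes A :: real
  assumes "2 \<le> A"
  shows "(A + 2) / (A\<^sup>2 + 3 * A + 3) \<le> (A + 1) / (A\<^sup>2 + 2 * A + 2) + 1 / 60"
proof -
  have A2: "2 * 2 \<le> A * A" using assms by (intro mult_mono) auto
  have nz: "A\<^sup>2 + 3 * A + 3 \<noteq> 0" "A\<^sup>2 + 2 * A + 2 \<noteq> 0"
    using assms A2 unfolding power2_eq_square by linarith+
  have eq: "(A + 2) / (A\<^sup>2 + 3 * A + 3) - (A + 1) / (A\<^sup>2 + 2 * A + 2)
      = 1 / ((A\<^sup>2 + 3 * A + 3) * (A\<^sup>2 + 2 * A + 2))"
    unfolding diff_frac_eq[OF nz]
    by (rule arg_cong2[where f = "(/)"]) (auto simp: algebra_simps power2_eq_square)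
  have "13 * 10 \<le> (A\<^sup>2 + 3 * A + 3) * (A\<^sup>2 + 2 * A + 2)"
    using assms A2 unfolding power2_eq_square by (intro mult_mono) linarith+
  then have "1 / ((A\<^sup>2 + 3 * A + 3) * (A\<^sup>2 + 2 * A + 2)) \<le> 1 / 60" by (intro frac_le) auto
  then show ?thesis using eq by linarith
qed

lemma digit_gap_eq:
  fixes A :: real
  assumes "2 \<le> A"
  shows "A / (A\<^sup>2 + 1) - (A + 2) / (A\<^sup>2 + 3 * A + 3)
    = (A\<^sup>2 + 2 * A - 2) / ((A\<^sup>2 + 1) * (A\<^sup>2 + 3 * A + 3))"
proof -
  have "0 < A\<^sup>2" using assms by simp
  then have nz: "A\<^sup>2 + 1 \<noteq> 0" "A\<^sup>2 + 3 * A + 3 \<noteq> 0" using assms by linarith+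
  show ?thesis unfolding diff_frac_eq[OF nz]
    by (rule arg_cong2[where f = "(/)"]) (auto simp: algebra_simps power2_eq_square)
qed

text \<open>Largest against smallest possible difference between the values of words starting with zero and
  with nonzero letters: the ranges are short compared with the gap between them.\<close>

lemma digit_spread_le:
  fixes A :: real
  assumes "2 \<le> A"
  shows "(A\<^sup>2 + 1) / (A * (A\<^sup>2 + 2)) - (A + 1) / (A\<^sup>2 + 2 * A + 2)
    \<le> 3 / 2 * (A / (A\<^sup>2 + 1) - (A + 2) / (A\<^sup>2 + 3 * A + 3))"
proof -
  have A2: "0 < A\<^sup>2" using assms by simp
  have pos: "0 < A * (A\<^sup>2 + 2)" "0 < A\<^sup>2 + 2 * A + 2" "0 < A\<^sup>2 + 1" "0 < A\<^sup>2 + 3 * A + 3"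
    using assms A2 by (auto intro!: mult_pos_pos add_pos_pos)
  have nz: "A * (A\<^sup>2 + 2) \<noteq> 0" "A\<^sup>2 + 2 * A + 2 \<noteq> 0" using pos by auto
  obtain c where c: "0 \<le> c" "A = 2 + c" using assms by (rule nonneg_poly_shift)
  have "3 * (A\<^sup>2 + 2 * A - 2) * (A * (A\<^sup>2 + 2) * (A\<^sup>2 + 2 * A + 2))
      - 2 * (A^3 + A\<^sup>2 + 2) * ((A\<^sup>2 + 1) * (A\<^sup>2 + 3 * A + 3))
      = 340 + 1460*c + 2002*c^2 + 1396*c^3 + 566*c^4 + 136*c^5 + 18*c^6 + c^7"
    unfolding c(2) by algebra
  also have "\<dots> \<ge> 0" using c by simp
  finally have le: "2 * (A^3 + A\<^sup>2 + 2) * ((A\<^sup>2 + 1) * (A\<^sup>2 + 3 * A + 3))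
      \<le> 3 * (A\<^sup>2 + 2 * A - 2) * (A * (A\<^sup>2 + 2) * (A\<^sup>2 + 2 * A + 2))" by simp
  have "(A\<^sup>2 + 1) / (A * (A\<^sup>2 + 2)) - (A + 1) / (A\<^sup>2 + 2 * A + 2)
      = (2 * (A^3 + A\<^sup>2 + 2)) / (2 * (A * (A\<^sup>2 + 2) * (A\<^sup>2 + 2 * A + 2)))"
    unfolding diff_frac_eq[OF nz] mult_divide_mult_cancel_left[OF zero_neq_numeral[symmetric]]
    by (rule arg_cong2[where f = "(/)"]) (auto simp: algebra_simps power2_eq_square power3_eq_cube)
  also have "\<dots> \<le> (3 * (A\<^sup>2 + 2 * A - 2)) / (2 * ((A\<^sup>2 + 1) * (A\<^sup>2 + 3 * A + 3)))"
  proof -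
    have "x / (2 * d) \<le> y / (2 * e)" if "x * e \<le> y * d" "0 < d" "0 < e" for x y d e :: real
      using that by (subst frac_le_frac_iff) auto
    from this[OF le] pos show ?thesis by simp
  qed
  also have "\<dots> = 3 / 2 * ((A\<^sup>2 + 2 * A - 2) / ((A\<^sup>2 + 1) * (A\<^sup>2 + 3 * A + 3)))" by simp
  finally show ?thesis unfolding digit_gap_eq[OF assms] .
qed

text \<open>The range of words starting with zero is of order \<open>A\<^sup>-\<^sup>5\<close>, the gap of order \<open>A\<^sup>-\<^sup>2\<close>, and the slopes
  differ by a factor of order \<open>A\<^sup>2\<close>: the gap still wins. The factor \<open>21/20\<close> leaves room for the
  distortion of the prefix.\<close>

lemma digit_gap_dominates_width:
  fixes A :: real
  assumes "2 \<le> A"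
  shows "21 / 20 * ((A\<^sup>2 + 1) / (A * (A\<^sup>2 + 2)) - A / (A\<^sup>2 + 1)) * (A\<^sup>2 + 2)\<^sup>2
    < (A / (A\<^sup>2 + 1) - (A + 2) / (A\<^sup>2 + 3 * A + 3)) * (A + 1)\<^sup>2"
proof -
  have A2: "0 < A\<^sup>2" using assms by simp
  have pos: "0 < A" "0 < A\<^sup>2 + 2" "0 < A\<^sup>2 + 1" "0 < A\<^sup>2 + 3 * A + 3"
    using assms A2 by (auto intro!: add_pos_pos)
  obtain c where c: "0 \<le> c" "A = 2 + c" using assms by (rule nonneg_poly_shift)
  have "20 * A * (A + 1)\<^sup>2 * (A\<^sup>2 + 2 * A - 2) - 21 * (A\<^sup>2 + 2) * (A\<^sup>2 + 3 * A + 3)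
      = 522 + 2706*c + 2853*c^2 + 1269*c^3 + 259*c^4 + 20*c^5"
    unfolding c(2) by algebra
  also have "\<dots> > 0" using c by (simp add: add_pos_nonneg)
  finally have "21 * (A\<^sup>2 + 2) * (A\<^sup>2 + 3 * A + 3) < 20 * A * (A + 1)\<^sup>2 * (A\<^sup>2 + 2 * A - 2)" by simp
  then have "21 * (A\<^sup>2 + 2) / (20 * A) < (A\<^sup>2 + 2 * A - 2) * (A + 1)\<^sup>2 / (A\<^sup>2 + 3 * A + 3)"
    using pos by (intro frac_less_frac_iff[THEN iffD2]) (simp_all only: mult_ac mult_pos_pos zero_less_numeral)
  then have "21 * (A\<^sup>2 + 2) / (20 * A) / (A\<^sup>2 + 1)
      < (A\<^sup>2 + 2 * A - 2) * (A + 1)\<^sup>2 / (A\<^sup>2 + 3 * A + 3) / (A\<^sup>2 + 1)"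
    using pos by (intro divide_strict_right_mono)
  moreover have "21 / 20 * (1 / (A * (A\<^sup>2 + 2) * (A\<^sup>2 + 1))) * (A\<^sup>2 + 2)\<^sup>2
      = 21 * (A\<^sup>2 + 2) / (20 * A) / (A\<^sup>2 + 1)"
  proof -
    have "21 / 20 * (1 / (A * m * n)) * m\<^sup>2 = 21 * m / (20 * A) / n" if "0 < m" for m n :: real
      using that pos by (simp add: power2_eq_square)
    then show ?thesis using pos by blast
  qed
  moreover have "(A\<^sup>2 + 2 * A - 2) / ((A\<^sup>2 + 1) * (A\<^sup>2 + 3 * A + 3)) * (A + 1)\<^sup>2
      = (A\<^sup>2 + 2 * A - 2) * (A + 1)\<^sup>2 / (A\<^sup>2 + 3 * A + 3) / (A\<^sup>2 + 1)"
    by simp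
  ultimately show ?thesis unfolding zero_range_width[OF assms] digit_gap_eq[OF assms] by (simp only:)
qed

text \<open>The first numerator is at most \<open>3/2\<close> times the second one, and the second denominator at most
  \<open>(61/60)\<^sup>2 < 4/3\<close> times the first one.\<close>

lemma prefix_gap_ratio:
  fixes A r s1 s2 t1 t2 :: real
  assumes A: "2 \<le> A" and r: "0 \<le> r" "r \<le> 1"
    and s1: "A / (A\<^sup>2 + 1) \<le> s1" "s1 \<le> (A\<^sup>2 + 1) / (A * (A\<^sup>2 + 2))"
    and s2: "A / (A\<^sup>2 + 1) \<le> s2" "s2 \<le> (A\<^sup>2 + 1) / (A * (A\<^sup>2 + 2))"
    and t1: "(A + 1) / (A\<^sup>2 + 2 * A + 2) \<le> t1" "t1 \<le> (A + 2) / (A\<^sup>2 + 3 * A + 3)"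
    and t2: "(A + 1) / (A\<^sup>2 + 2 * A + 2) \<le> t2" "t2 \<le> (A + 2) / (A\<^sup>2 + 3 * A + 3)"
  shows "(s1 - t1) / ((1 + r * s1) * (1 + r * t1)) < 2 * ((s2 - t2) / ((1 + r * s2) * (1 + r * t2)))"
proof -
  note gap = digit_gap_pos[OF A]
  have "0 \<le> A / (A\<^sup>2 + 1)" "0 \<le> (A + 1) / (A\<^sup>2 + 2 * A + 2)" using A by auto
  then have nn: "0 \<le> s1" "0 \<le> s2" "0 \<le> t1" "0 \<le> t2" using s1 s2 t1 t2 by linarith+
  then have nr: "0 \<le> r * s1" "0 \<le> r * s2" "0 \<le> r * t1" "0 \<le> r * t2" using r by simp_all
  have pos: "0 < 1 + r * s" if "0 \<le> s" for s using r that by (simp add: add_pos_nonneg)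
  have "1 + r * s2 \<le> (1 + 1/60) * (1 + r * s1)" "1 + r * t2 \<le> (1 + 1/60) * (1 + r * t1)"
    using zero_range_width_le[OF A] nonzero_range_width_le[OF A] s1 s2 t1 t2 nn r
    by (intro moebius_denominator_ratio; linarith)+
  then have "(1 + r * s2) * (1 + r * t2) \<le> ((1 + 1/60) * (1 + r * s1)) * ((1 + 1/60) * (1 + r * t1))"
    using pos nn nr by (intro mult_mono) (auto intro: less_imp_le)
  also have "\<dots> = (1 + 1/60)\<^sup>2 * ((1 + r * s1) * (1 + r * t1))" by (simp only: power2_eq_square mult_ac)
  also have "\<dots> < 4 / 3 * ((1 + r * s1) * (1 + r * t1))"
    using pos nn by (intro mult_strict_right_mono) (auto simp: power2_eq_square)
  finally have weights: "(1 + r * s2) * (1 + r * t2) < 4 / 3 * ((1 + r * s1) * (1 + r * t1))" .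
  have gap2: "0 < s2 - t2" using s2 t2 gap by linarith
  have "s1 - t1 \<le> (A\<^sup>2 + 1) / (A * (A\<^sup>2 + 2)) - (A + 1) / (A\<^sup>2 + 2 * A + 2)"
    using s1 t1 by (intro diff_mono)
  also have "\<dots> \<le> 3 / 2 * (A / (A\<^sup>2 + 1) - (A + 2) / (A\<^sup>2 + 3 * A + 3))" by (rule digit_spread_le[OF A])
  also have "\<dots> \<le> 3 / 2 * (s2 - t2)" using s2 t2 by (intro mult_left_mono diff_mono) auto
  finally have num: "s1 - t1 \<le> 3 / 2 * (s2 - t2)" .
  have "(s1 - t1) * ((1 + r * s2) * (1 + r * t2)) \<le> 3 / 2 * (s2 - t2) * ((1 + r * s2) * (1 + r * t2))"
    using num pos nn by (intro mult_right_mono) (auto intro: less_imp_le)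
  also have "\<dots> < 3 / 2 * (s2 - t2) * (4 / 3 * ((1 + r * s1) * (1 + r * t1)))"
    using weights gap2 by (intro mult_strict_left_mono) auto
  also have "\<dots> = (2 * (s2 - t2)) * ((1 + r * s1) * (1 + r * t1))"
  proof -
    have "3 / 2 * d * (4 / 3 * e) = 2 * d * e" for d e :: real by simp
    then show ?thesis .
  qed
  finally have "(s1 - t1) * ((1 + r * s2) * (1 + r * t2)) < (2 * (s2 - t2)) * ((1 + r * s1) * (1 + r * t1))" .
  then have "(s1 - t1) / ((1 + r * s1) * (1 + r * t1)) < (2 * (s2 - t2)) / ((1 + r * s2) * (1 + r * t2))"
    using pos nn by (subst frac_less_frac_iff) auto
  then show ?thesis by simp
qed

text \<open>The distortion by the prefix costs at most the factor \<open>21/20\<close> provided for in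
  \<open>digit_gap_dominates_width\<close>.\<close>

lemma prefix_gap_dominates:
  fixes A r s s1 s2 t :: real
  assumes A: "2 \<le> A" and r: "0 \<le> r" "r \<le> 1"
    and s: "A / (A\<^sup>2 + 1) \<le> s" "s \<le> (A\<^sup>2 + 1) / (A * (A\<^sup>2 + 2))"
    and s1: "A / (A\<^sup>2 + 1) \<le> s1" "s1 \<le> (A\<^sup>2 + 1) / (A * (A\<^sup>2 + 2))"
    and s2: "A / (A\<^sup>2 + 1) \<le> s2" "s2 \<le> (A\<^sup>2 + 1) / (A * (A\<^sup>2 + 2))"
    and t: "(A + 1) / (A\<^sup>2 + 2 * A + 2) \<le> t" "t \<le> (A + 2) / (A\<^sup>2 + 3 * A + 3)"
  shows "(s2 - s) / ((1 + r * s2) * (1 + r * s)) * (A\<^sup>2 + 2)\<^sup>2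
    < (s1 - t) / ((1 + r * s1) * (1 + r * t)) * (A + 1)\<^sup>2"
proof -
  note gap = digit_gap_pos[OF A]
  have "0 \<le> A / (A\<^sup>2 + 1)" "0 \<le> (A + 1) / (A\<^sup>2 + 2 * A + 2)" using A by auto
  then have nn: "0 \<le> s" "0 \<le> s1" "0 \<le> s2" "0 \<le> t" using s s1 s2 t by linarith+
  then have nr: "0 \<le> r * s" "0 \<le> r * s1" "0 \<le> r * s2" "0 \<le> r * t" using r by simp_all
  have pos: "0 < 1 + r * s" if "0 \<le> s" for s using r that by (simp add: add_pos_nonneg)
  have "1 + r * s1 \<le> (1 + 1/60) * (1 + r * s2)"
    using zero_range_width_le[OF A] s1 s2 nn r by (intro moebius_denominator_ratio; linarith)
  moreover have "1 + r * t \<le> (1 + 0) * (1 + r * s)"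
    using gap s t nn r by (intro moebius_denominator_ratio; linarith)
  ultimately have "(1 + r * s1) * (1 + r * t) \<le> ((1 + 1/60) * (1 + r * s2)) * ((1 + 0) * (1 + r * s))"
    using pos nn nr by (intro mult_mono) (auto intro: less_imp_le)
  also have "\<dots> = 61/60 * ((1 + r * s2) * (1 + r * s))" by simp
  also have "\<dots> \<le> 21/20 * ((1 + r * s2) * (1 + r * s))"
    using pos nn by (intro mult_right_mono) (auto intro: less_imp_le)
  finally have weights: "(1 + r * s1) * (1 + r * t) \<le> 21/20 * ((1 + r * s2) * (1 + r * s))" .
  let ?w = "(A\<^sup>2 + 1) / (A * (A\<^sup>2 + 2)) - A / (A\<^sup>2 + 1)"
  have w: "0 \<le> ?w" using s by linarith
  let ?p = "(1 + r * s1) * (1 + r * t)" and ?q = "(1 + r * s2) * (1 + r * s)"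
  have pq: "0 < ?p" "0 < ?q" using pos nn by auto
  have "(s2 - s) / ?q * (A\<^sup>2 + 2)\<^sup>2 \<le> ?w / ?q * (A\<^sup>2 + 2)\<^sup>2"
    using s s2 pq by (intro mult_right_mono divide_right_mono) auto
  also have "\<dots> \<le> ?w * (21 / 20) / ?p * (A\<^sup>2 + 2)\<^sup>2"
  proof (intro mult_right_mono)
    have "?w * ?p \<le> ?w * (21 / 20 * ?q)" using weights w by (rule mult_left_mono)
    then show "?w / ?q \<le> ?w * (21 / 20) / ?p"
      using pq by (intro frac_le_frac_iff[THEN iffD2]) (simp_all only: mult.assoc)
  qed simp
  also have "\<dots> = 21 / 20 * ?w * (A\<^sup>2 + 2)\<^sup>2 / ?p"
    by (simp only: times_divide_eq_left mult.commute[of ?w])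
  also have "\<dots> < (A / (A\<^sup>2 + 1) - (A + 2) / (A\<^sup>2 + 3 * A + 3)) * (A + 1)\<^sup>2 / ?p"
    using digit_gap_dominates_width[OF A] pq by (intro divide_strict_right_mono)
  also have "\<dots> \<le> (s1 - t) * (A + 1)\<^sup>2 / ?p"
    using s1 t pq by (intro divide_right_mono mult_right_mono) auto
  finally show ?thesis by simp
qed

section \<open>Two-sided values of doubled words\<close>

definition doubled_word :: "int \<Rightarrow> (int \<Rightarrow> int) \<Rightarrow> int \<Rightarrow> int" where
  "doubled_word a s n = letter a (s (n div 2))"

text \<open>The two-sided value at one copy of the letter \<open>l\<close>: \<open>f\<close> is the undoubled word on the side of the
  other copy, \<open>g\<close> the one on the opposite side, both read away from \<open>l\<close>.\<close>

definition point_value :: "int \<Rightarrow> int \<Rightarrow> (nat \<Rightarrow> int) \<Rightarrow> (nat \<Rightarrow> int) \<Rightarrow> real" where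
  "point_value a l f g = letter a l + 1 / (letter a l + doubled_cf a f) + doubled_cf a g"

context
  fixes a :: int
  assumes a: "2 \<le> a"
begin

lemma corner_value_mono:
  assumes "0 \<le> u" "u \<le> u'" "0 \<le> v'" "v' \<le> v"
  shows "corner_value a u v \<le> corner_value a u' v'"
  unfolding corner_value_def
  using assms a by (intro add_mono pair_map_mono frac_le) auto

text \<open>The least value occurs at \<open>u = 0\<close>, \<open>v = 1/a\<close> and is \<open>a/(a\<^sup>2 + 1) + a/(a\<^sup>2 + a + 1)\<close>; the first summand
  exceeds \<open>1/(a + 1)\<close> by more than the second one falls short of it. The bound separates corners
  from all positions inside runs of equal letters.\<close>

lemma corner_value_gt:
  assumes "0 \<le> u" "0 \<le> v" "v \<le> 1 / a"
  shows "2 / (real_of_int a + 1) < corner_value a u v"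
proof -
  let ?A = "real_of_int a"
  have A: "2 \<le> ?A" using a by simp
  have AA: "2 * ?A \<le> ?A * ?A" using A by (intro mult_right_mono) auto
  have AAA: "2 * (?A * ?A) \<le> ?A * (?A * ?A)" using A by (intro mult_right_mono) auto
  have "2 / (?A + 1) < ?A / (?A\<^sup>2 + 1) + ?A / (?A\<^sup>2 + ?A + 1)"
  proof -
    have p: "0 < ?A + 1" "0 < ?A\<^sup>2 + 1" "0 < ?A\<^sup>2 + ?A + 1" using A by (auto intro: add_pos_pos add_nonneg_pos)
    have "1 / (?A + 1) - ?A / (?A\<^sup>2 + ?A + 1) = 1 / ((?A + 1) * (?A\<^sup>2 + ?A + 1))"
      using p by (subst diff_frac_eq) (auto simp: algebra_simps power2_eq_square)
    also have "\<dots> < (?A - 1) / ((?A + 1) * (?A\<^sup>2 + 1))"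
    proof -
      have "?A\<^sup>2 + 1 < (?A - 1) * (?A\<^sup>2 + ?A + 1)"
      proof -
        have "2 + ?A * ?A < ?A * (?A * ?A)" using AA AAA A by linarith
        then show ?thesis by (simp add: algebra_simps power2_eq_square)
      qed
      then have "1 / (?A\<^sup>2 + ?A + 1) < (?A - 1) / (?A\<^sup>2 + 1)"
        using p by (subst frac_less_frac_iff) auto
      from divide_strict_right_mono[OF this p(1)] show ?thesis by (simp add: mult.commute)
    qed
    also have "\<dots> = ?A / (?A\<^sup>2 + 1) - 1 / (?A + 1)"
      using p by (subst diff_frac_eq) (auto simp: algebra_simps power2_eq_square)
    finally show ?thesis by simp
  qed
  also have "?A / (?A\<^sup>2 + 1) = pair_map ?A 0" using A by (simp add: pair_map_eq)
  also have "?A / (?A\<^sup>2 + ?A + 1) = 1 / (?A + 1 + 1 / ?A)"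
    using A by (simp add: field_simps power2_eq_square)
  also have "pair_map ?A 0 + 1 / (?A + 1 + 1 / ?A) = corner_value a 0 (1 / a)"
    by (simp add: corner_value_def)
  also have "\<dots> \<le> corner_value a u v" using assms by (intro corner_value_mono) auto
  finally show ?thesis by simp
qed

lemma two_sided_value_even:
  "two_sided_value (doubled_word a s) (2 * k)
     = point_value a (s k) (\<lambda>i. s (k + 1 + int i)) (\<lambda>i. s (k - 1 - int i))"
proof -
  have "(2 * k + 1 + int i) div 2 = k + int (Suc i div 2)" for i by linarith
  then have "cf_lim (\<lambda>i. doubled_word a s (2 * k + 1 + int i))
      = 1 / (letter a (s k) + doubled_cf a (\<lambda>i. s (k + 1 + int i)))"
    using doubled_cf_tail[OF a, of "\<lambda>i. s (k + int i)"] by (simp add: doubled_word_def algebra_simps)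
  moreover have "(2 * k - 1 - int i) div 2 = k - 1 - int (i div 2)" for i by linarith
  then have "cf_lim (\<lambda>i. doubled_word a s (2 * k - 1 - int i)) = doubled_cf a (\<lambda>i. s (k - 1 - int i))"
    by (simp add: doubled_word_def doubled_cf_def)
  ultimately show ?thesis by (simp add: two_sided_value_def point_value_def doubled_word_def)
qed

lemma two_sided_value_odd:
  "two_sided_value (doubled_word a s) (2 * k + 1)
     = point_value a (s k) (\<lambda>i. s (k - 1 - int i)) (\<lambda>i. s (k + 1 + int i))"
proof -
  have half: "(2 * k + 1 - 1 - int i) div 2 = k - int (Suc i div 2)" for i by linarith
  have "cf_lim (\<lambda>i. doubled_word a s (2 * k + 1 - 1 - int i))
      = cf_lim (\<lambda>i. letter a (s (k - int (Suc i div 2))))"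
    by (simp only: doubled_word_def half)
  also have "\<dots> = 1 / (letter a (s k) + doubled_cf a (\<lambda>i. s (k - 1 - int i)))"
    using doubled_cf_tail[OF a, of "\<lambda>i. s (k - int i)"] by (simp add: algebra_simps)
  finally have "cf_lim (\<lambda>i. doubled_word a s (2 * k + 1 - 1 - int i))
      = 1 / (letter a (s k) + doubled_cf a (\<lambda>i. s (k - 1 - int i)))" .
  moreover have "(2 * k + 1 + 1 + int i) div 2 = k + 1 + int (i div 2)" for i by linarith
  then have "cf_lim (\<lambda>i. doubled_word a s (2 * k + 1 + 1 + int i)) = doubled_cf a (\<lambda>i. s (k + 1 + int i))"
    by (simp add: doubled_word_def doubled_cf_def)
  ultimately show ?thesis by (simp add: two_sided_value_def point_value_def doubled_word_def)
qed

lemma point_value_zero_le: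
  assumes "l = 0"
  shows "point_value a l f g \<le> a + 1"
proof -
  have "1 / (a + doubled_cf a f) \<le> 1 / a"
    using doubled_cf_bounds[OF a, of f] a by (intro frac_le) auto
  moreover have "doubled_cf a g \<le> 1 / a" by (rule doubled_cf_bounds[OF a])
  moreover have "1 / real_of_int a \<le> 1 / 2" using a by (intro frac_le) auto
  ultimately show ?thesis using assms by (simp add: point_value_def letter_def)
qed

lemma point_value_interior_le:
  assumes "l \<noteq> 0" "g 0 \<noteq> 0"
  shows "point_value a l f g \<le> a + 1 + 2 / (real_of_int a + 1)"
proof -
  let ?A = "real_of_int a"
  have A: "2 \<le> ?A" using a by simp
  have "1 / (?A + 1 + doubled_cf a f) \<le> 1 / (?A + 1)"
    using doubled_cf_bounds[OF a, of f] a by (intro frac_le) auto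
  moreover have "(?A + 2) / (?A\<^sup>2 + 3 * ?A + 3) \<le> 1 / (?A + 1)"
    using A by (subst frac_le_frac_iff) (auto simp: algebra_simps power2_eq_square intro!: add_pos_pos)
  then have "doubled_cf a g \<le> 1 / (?A + 1)"
    using doubled_cf_nonzero_bounds(2)[OF a, of g] assms by simp
  ultimately show ?thesis using assms by (simp add: point_value_def letter_def)
qed

lemma point_value_corner:
  assumes "l \<noteq> 0" "g 0 = 0"
  shows "point_value a l f g = a + 1 + corner_value a (doubled_cf a (\<lambda>i. g (Suc i))) (doubled_cf a f)"
  using assms doubled_cf_unfold[OF a, of g] by (simp add: point_value_def corner_value_def letter_def)

lemma point_value_gt:
  assumes "l \<noteq> 0"
  shows "real_of_int a + 1 < point_value a l f g"
proof -
  have "point_value a l f g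
      = real_of_int a + 1 + 1 / (real_of_int a + 1 + doubled_cf a f) + doubled_cf a g"
    using assms by (simp add: point_value_def letter_def)
  moreover have "0 < 1 / (real_of_int a + 1 + doubled_cf a f)"
    using doubled_cf_bounds[OF a, of f] a by (intro divide_pos_pos) auto
  moreover have "0 \<le> doubled_cf a g" by (rule doubled_cf_bounds[OF a])
  ultimately show ?thesis by linarith
qed

end

section \<open>Mechanical words\<close>

definition mechanical :: "real \<Rightarrow> int \<Rightarrow> int" where
  "mechanical x k = \<lfloor>(k + 1) * x\<rfloor> - \<lfloor>k * x\<rfloor>"

lemma mechanical_binary:
  assumes "0 \<le> x" "x \<le> 1"
  shows "mechanical x k \<in> {0, 1}"
proof -
  have "\<lfloor>k * x\<rfloor> \<le> \<lfloor>k * x + x\<rfloor>" "\<lfloor>k * x + x\<rfloor> \<le> \<lfloor>k * x\<rfloor> + 1" using assms by linarith+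
  then show ?thesis unfolding mechanical_def by (auto simp: algebra_simps)
qed

lemma sum_mechanical_right:
  fixes x :: real
  shows "(\<Sum>i<n. mechanical x (k + int i)) = \<lfloor>(k + int n) * x\<rfloor> - \<lfloor>k * x\<rfloor>"
  by (induction n) (auto simp: mechanical_def algebra_simps)

lemma sum_mechanical_left:
  fixes x :: real
  shows "(\<Sum>i<n. mechanical x (k - int i)) = \<lfloor>(k + 1) * x\<rfloor> - \<lfloor>(k + 1 - int n) * x\<rfloor>"
  by (induction n) (auto simp: mechanical_def algebra_simps)

lemma mechanical_periodic:
  assumes "x = real_of_int p / real_of_int q" "0 < q"
  shows "mechanical x (k + q * t) = mechanical x k"
proof -
  have "\<lfloor>real_of_int (j + q * t) * x\<rfloor> = \<lfloor>real_of_int j * x\<rfloor> + p * t" for j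
  proof -
    have "real_of_int (j + q * t) * x = real_of_int j * x + real_of_int (p * t)"
      using assms by (simp add: field_simps)
    then show ?thesis by linarith
  qed
  from this[of k] this[of "k + 1"] show ?thesis by (simp add: mechanical_def algebra_simps)
qed

lemma phi_nth: "phi a b w !! i = (if w !! (i div 2) = 0 then a else b)"
proof -
  have "flat (smap (phi_letter a b) w) !! i = (if w !! (i div 2) = 0 then a else b)" for w
  proof (induction i arbitrary: w rule: induct_nat_012)
    case 0
    then show ?case by (subst flat_unfold) (auto simp: phi_letter_def[of a b "shd w"])
  next
    case 1
    then show ?case by (subst flat_unfold) (auto simp: phi_letter_def[of a b "shd w"])
  next
    case (ge2 n)
    then show ?case by (subst flat_unfold) (auto simp: phi_letter_def[of a b "shd w"])
  qed
  then show ?thesis unfolding phi_def .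
qed

lemma G_word_nth: "G_word x !! i = mechanical x (int i)"
  by (simp add: G_word_def G_letter_def mechanical_def algebra_simps)

text \<open>The corner at the origin is \<open>mechanical x (-1) = 1\<close>, \<open>mechanical x 0 = 0\<close>. The right and left
  words are what remains on either side after removing these two letters.\<close>

definition right_word :: "real \<Rightarrow> nat \<Rightarrow> int" where
  "right_word x i = mechanical x (1 + int i)"

definition left_word :: "real \<Rightarrow> nat \<Rightarrow> int" where
  "left_word x i = mechanical x (-2 - int i)"

section \<open>The Lagrange constant of a rational slope\<close>

definition mechanical_corner :: "int \<Rightarrow> real \<Rightarrow> real" where
  "mechanical_corner a x = corner_value a (doubled_cf a (right_word x)) (doubled_cf a (left_word x))"

context
  fixes a :: int
  assumes a: "2 \<le> a"
begin

lemma cf_value_phi_G_word: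
  "cf_value (phi a (a + 1) (G_word x)) = cf_lim (\<lambda>i. doubled_word a (mechanical x) (int i))"
proof -
  have "snth (phi a (a + 1) (G_word x)) = (\<lambda>i. doubled_word a (mechanical x) (int i))"
    by (rule ext) (simp add: phi_nth G_word_nth doubled_word_def letter_def zdiv_int)
  then show ?thesis by (simp add: cf_value_eq_cf_lim)
qed

lemma doubled_word_ge: "2 \<le> doubled_word a s n"
  unfolding doubled_word_def by (rule letter_ge(2)[OF a])

lemma lagrange_const_doubled_le:
  assumes "\<And>k. point_value a (s k) (\<lambda>i. s (k + 1 + int i)) (\<lambda>i. s (k - 1 - int i)) \<le> L"
    and "\<And>k. point_value a (s k) (\<lambda>i. s (k - 1 - int i)) (\<lambda>i. s (k + 1 + int i)) \<le> L"
  shows "lagrange_const (cf_lim (\<lambda>i. doubled_word a s (int i))) \<le> ereal L"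
proof (rule lagrange_const_le[OF doubled_word_ge])
  fix n :: int
  show "two_sided_value (doubled_word a s) n \<le> L"
  proof (cases "even n")
    case True
    then obtain k where "n = 2 * k" by blast
    then show ?thesis using assms two_sided_value_even[OF a, of s k] by simp
  next
    case False
    then obtain k where "n = 2 * k + 1" by (rule oddE)
    then show ?thesis using assms two_sided_value_odd[OF a, of s k] by simp
  qed
qed

lemma lagrange_const_doubled_ge:
  assumes "\<And>N. \<exists>k\<ge>N. L \<le> point_value a (s k) (\<lambda>i. s (k - 1 - int i)) (\<lambda>i. s (k + 1 + int i))"
  shows "ereal L \<le> lagrange_const (cf_lim (\<lambda>i. doubled_word a s (int i)))"
proof (rule lagrange_const_ge[OF doubled_word_ge])
  fix N :: nat
  obtain k where k: "k \<ge> int N"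
    "L \<le> point_value a (s k) (\<lambda>i. s (k - 1 - int i)) (\<lambda>i. s (k + 1 + int i))"
    using assms by blast
  then have "L \<le> two_sided_value (doubled_word a s) (int (nat (2 * k + 1)))" "nat (2 * k + 1) \<ge> N"
    using two_sided_value_odd[OF a, of s k] by simp_all
  then show "\<exists>n\<ge>N. L \<le> two_sided_value (doubled_word a s) (int n)" by blast
qed

text \<open>Removing a letter \<open>0\<close> costs nothing in the prefix sums, and by superadditivity of the floor any
  \<open>n + 1\<close> consecutive letters have sum at least \<open>\<lfloor>(n + 1) x\<rfloor>\<close>, the sum reached at the origin.\<close>

lemma mechanical_right_extremal:
  assumes x: "0 \<le> x" "x < 1"
  shows "mechanical x j = 0 \<Longrightarrow> doubled_cf a (\<lambda>i. mechanical x (j + 1 + int i)) \<le> doubled_cf a (right_word x)"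
    and "mechanical x j = 0 \<Longrightarrow> doubled_cf a (\<lambda>i. mechanical x (j - 1 - int i)) \<le> doubled_cf a (right_word x)"
proof -
  have bin: "mechanical x k \<in> {0, 1}" for k using mechanical_binary[of x k] x by auto
  have R: "sum (right_word x) {..<n} = \<lfloor>(1 + int n) * x\<rfloor>" for n
  proof -
    have "sum (right_word x) {..<n} = (\<Sum>i<n. mechanical x (1 + int i))" by (simp add: right_word_def)
    also have "\<dots> = \<lfloor>(1 + int n) * x\<rfloor> - \<lfloor>x\<rfloor>" using sum_mechanical_right[where x = x and k = 1 and n = n] by simp
    also have "\<lfloor>x\<rfloor> = 0" using x by linarith
    finally show ?thesis by simp
  qed
  assume "mechanical x j = 0"
  then have j: "\<lfloor>(j + 1) * x\<rfloor> = \<lfloor>j * x\<rfloor>" by (simp add: mechanical_def)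
  show "doubled_cf a (\<lambda>i. mechanical x (j + 1 + int i)) \<le> doubled_cf a (right_word x)"
  proof (rule doubled_cf_antimono_sums[OF a])
    fix n
    have "\<lfloor>j * x\<rfloor> + \<lfloor>(1 + int n) * x\<rfloor> \<le> \<lfloor>j * x + (1 + int n) * x\<rfloor>" by (rule le_floor_add)
    then show "sum (right_word x) {..<n} \<le> (\<Sum>i<n. mechanical x (j + 1 + int i))"
      unfolding R sum_mechanical_right using j by (simp add: algebra_simps)
  qed (use bin in \<open>auto simp: right_word_def\<close>)
  show "doubled_cf a (\<lambda>i. mechanical x (j - 1 - int i)) \<le> doubled_cf a (right_word x)"
  proof (rule doubled_cf_antimono_sums[OF a])
    fix n
    have "\<lfloor>(j - int n) * x\<rfloor> + \<lfloor>(1 + int n) * x\<rfloor> \<le> \<lfloor>(j - int n) * x + (1 + int n) * x\<rfloor>"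
      by (rule le_floor_add)
    then show "sum (right_word x) {..<n} \<le> (\<Sum>i<n. mechanical x (j - 1 - int i))"
      unfolding R sum_mechanical_left using j by (simp add: algebra_simps)
  qed (use bin in \<open>auto simp: right_word_def\<close>)
qed

text \<open>Dually, any \<open>n + 1\<close> consecutive letters have sum at most \<open>\<lceil>(n + 1) x\<rceil>\<close>, and removing a letter
  \<open>1\<close> lowers this by one; the word to the left of the origin reaches the bound.\<close>

lemma mechanical_left_extremal:
  assumes x: "0 < x" "x \<le> 1"
  shows "mechanical x j = 1 \<Longrightarrow> doubled_cf a (left_word x) \<le> doubled_cf a (\<lambda>i. mechanical x (j + 1 + int i))"
    and "mechanical x j = 1 \<Longrightarrow> doubled_cf a (left_word x) \<le> doubled_cf a (\<lambda>i. mechanical x (j - 1 - int i))"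
proof -
  have bin: "mechanical x k \<in> {0, 1}" for k using mechanical_binary[of x k] x by auto
  have L: "sum (left_word x) {..<n} = - 1 - \<lfloor>(- 1 - int n) * x\<rfloor>" for n
  proof -
    have "sum (left_word x) {..<n} = (\<Sum>i<n. mechanical x (-2 - int i))" by (simp add: left_word_def)
    also have "\<dots> = \<lfloor>- x\<rfloor> - \<lfloor>(- 1 - int n) * x\<rfloor>" using sum_mechanical_left[where x = x and k = "-2" and n = n] by simp
    also have "\<lfloor>- x\<rfloor> = -1" using x by linarith
    finally show ?thesis by simp
  qed
  assume "mechanical x j = 1"
  then have j: "\<lfloor>(j + 1) * x\<rfloor> = \<lfloor>j * x\<rfloor> + 1" by (simp add: mechanical_def)
  show "doubled_cf a (left_word x) \<le> doubled_cf a (\<lambda>i. mechanical x (j + 1 + int i))"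
  proof (rule doubled_cf_antimono_sums[OF a])
    fix n
    have "\<lfloor>(j + 1 + int n) * x\<rfloor> + \<lfloor>(- 1 - int n) * x\<rfloor> \<le> \<lfloor>(j + 1 + int n) * x + (- 1 - int n) * x\<rfloor>"
      by (rule le_floor_add)
    then show "(\<Sum>i<n. mechanical x (j + 1 + int i)) \<le> sum (left_word x) {..<n}"
      unfolding L sum_mechanical_right using j by (simp add: algebra_simps)
  qed (use bin in \<open>auto simp: left_word_def\<close>)
  show "doubled_cf a (left_word x) \<le> doubled_cf a (\<lambda>i. mechanical x (j - 1 - int i))"
  proof (rule doubled_cf_antimono_sums[OF a])
    fix n
    have "\<lfloor>(j + 1) * x\<rfloor> + \<lfloor>(- 1 - int n) * x\<rfloor> \<le> \<lfloor>(j + 1) * x + (- 1 - int n) * x\<rfloor>"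
      by (rule le_floor_add)
    then show "(\<Sum>i<n. mechanical x (j - 1 - int i)) \<le> sum (left_word x) {..<n}"
      unfolding L sum_mechanical_left using j by (simp add: algebra_simps)
  qed (use bin in \<open>auto simp: left_word_def\<close>)
qed

text \<open>The two alternatives for \<open>f\<close> and \<open>g\<close> are the two copies of a letter, or the two directions of
  reading; extremality holds in both directions.\<close>

lemma point_value_mechanical_le:
  assumes "f = (\<lambda>i. mechanical x (k + 1 + int i)) \<and> g = (\<lambda>i. mechanical x (k - 1 - int i))
    \<or> f = (\<lambda>i. mechanical x (k - 1 - int i)) \<and> g = (\<lambda>i. mechanical x (k + 1 + int i))"
    and x: "0 < x" "x < 1"
  shows "point_value a (mechanical x k) f g \<le> a + 1 + mechanical_corner a x"
proof -
  have big: "2 / (real_of_int a + 1) < mechanical_corner a x"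
    unfolding mechanical_corner_def by (intro corner_value_gt[OF a] doubled_cf_bounds[OF a])
  have "0 \<le> 2 / (real_of_int a + 1)" using a by simp
  then have pos: "0 \<le> mechanical_corner a x" using big by linarith
  consider "mechanical x k = 0" | "mechanical x k \<noteq> 0" "g 0 \<noteq> 0" | "mechanical x k \<noteq> 0" "g 0 = 0" by blast
  then show ?thesis
  proof cases
    case 1
    then show ?thesis using point_value_zero_le[OF a, of "mechanical x k" f g] pos by linarith
  next
    case 2
    then show ?thesis using point_value_interior_le[OF a, of "mechanical x k" g f] big by linarith
  next
    case 3
    then have one: "mechanical x k = 1" using mechanical_binary[of x k] x by auto
    have "doubled_cf a (\<lambda>i. g (Suc i)) \<le> doubled_cf a (right_word x)"
      using assms(1)
    proof
      assume fg: "f = (\<lambda>i. mechanical x (k + 1 + int i)) \<and> g = (\<lambda>i. mechanical x (k - 1 - int i))"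
      then have "mechanical x (k - 1) = 0" using 3 by simp
      from mechanical_right_extremal(2)[OF _ _ this] x fg show ?thesis by (simp add: algebra_simps)
    next
      assume fg: "f = (\<lambda>i. mechanical x (k - 1 - int i)) \<and> g = (\<lambda>i. mechanical x (k + 1 + int i))"
      then have "mechanical x (k + 1) = 0" using 3 by simp
      from mechanical_right_extremal(1)[OF _ _ this] x fg show ?thesis by (simp add: algebra_simps)
    qed
    moreover have "doubled_cf a (left_word x) \<le> doubled_cf a f"
      using assms(1) mechanical_left_extremal[OF _ _ one] x by auto
    ultimately show ?thesis
      unfolding point_value_corner[OF a, of "mechanical x k" g f, OF 3] mechanical_corner_def
      using corner_value_mono[OF a] doubled_cf_bounds[OF a] by simp
  qed
qed

lemma lagrange_const_G_word:
  assumes x: "0 < x" "x < 1" "x \<in> \<rat>"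
  shows "lagrange_const (cf_value (phi a (a + 1) (G_word x))) = ereal (a + 1 + mechanical_corner a x)"
  unfolding cf_value_phi_G_word
proof (rule antisym)
  show "lagrange_const (cf_lim (\<lambda>i. doubled_word a (mechanical x) (int i))) \<le> ereal (a + 1 + mechanical_corner a x)"
    by (intro lagrange_const_doubled_le point_value_mechanical_le x) auto
  obtain p q where pq: "0 < q" "x = real_of_int p / real_of_int q"
    using x(3) by (rule Rats_cases')
  show "ereal (a + 1 + mechanical_corner a x) \<le> lagrange_const (cf_lim (\<lambda>i. doubled_word a (mechanical x) (int i)))"
  proof (rule lagrange_const_doubled_ge)
    fix N :: int
    \<comment> \<open>The corner at the origin reappears at \<open>q t\<close>.\<close>
    define t where "t = \<bar>N\<bar> + 1"
    have per: "mechanical x (j + q * t) = mechanical x j" for j by (rule mechanical_periodic[OF pq(2,1)])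
    have "\<lfloor>- x\<rfloor> = -1" "\<lfloor>x\<rfloor> = 0" using x by linarith+
    then have m: "mechanical x (-1) = 1" "mechanical x 0 = 0" using x by (auto simp: mechanical_def)
    have L: "left_word x = (\<lambda>i. mechanical x (-1 + q * t - 1 - int i))"
      using per[of "-2 - int _"] by (auto simp: left_word_def algebra_simps)
    have R: "right_word x = (\<lambda>i. mechanical x (-1 + q * t + 1 + int (Suc i)))"
      using per[of "1 + int _"] by (auto simp: right_word_def algebra_simps)
    have "point_value a (mechanical x (-1 + q * t)) (\<lambda>i. mechanical x (-1 + q * t - 1 - int i))
        (\<lambda>i. mechanical x (-1 + q * t + 1 + int i)) = a + 1 + mechanical_corner a x"
      unfolding mechanical_corner_def L R
      by (rule point_value_corner[OF a]) (use m per[of "-1"] per[of 0] in \<open>auto simp: algebra_simps\<close>)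
    moreover have "t \<le> q * t" using mult_right_mono[of 1 q t] pq t_def by simp
    then have "N \<le> -1 + q * t" using t_def by linarith
    ultimately show "\<exists>k\<ge>N. a + 1 + mechanical_corner a x
        \<le> point_value a (mechanical x k) (\<lambda>i. mechanical x (k - 1 - int i)) (\<lambda>i. mechanical x (k + 1 + int i))"
      by (intro exI[of _ "-1 + q * t"]) auto
  qed
qed

lemma lagrange_const_G_word_gt:
  assumes x: "0 < x" "x < 1" "x \<in> \<rat>"
  shows "ereal (a + 1 + 2 / (real_of_int a + 1)) < lagrange_const (cf_value (phi a (a + 1) (G_word x)))"
  unfolding lagrange_const_G_word[OF x] mechanical_corner_def
  using corner_value_gt[OF a] doubled_cf_bounds[OF a] by simp

lemma lagrange_const_G_word_0:
  "lagrange_const (cf_value (phi a (a + 1) (G_word 0))) \<le> ereal (a + 1)"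
  unfolding cf_value_phi_G_word
  by (intro lagrange_const_doubled_le point_value_zero_le[OF a]) (auto simp: mechanical_def)

lemma mechanical_1: "mechanical 1 k = 1"
  by (simp add: mechanical_def)

lemma lagrange_const_G_word_1:
  "lagrange_const (cf_value (phi a (a + 1) (G_word 1))) \<le> ereal (a + 1 + 2 / (real_of_int a + 1))"
  "ereal (a + 1) < lagrange_const (cf_value (phi a (a + 1) (G_word 1)))"
proof -
  show "lagrange_const (cf_value (phi a (a + 1) (G_word 1))) \<le> ereal (a + 1 + 2 / (real_of_int a + 1))"
    unfolding cf_value_phi_G_word
    by (intro lagrange_const_doubled_le point_value_interior_le[OF a]) (auto simp: mechanical_1)
  let ?L = "point_value a 1 (\<lambda>i. 1) (\<lambda>i. 1)"
  have "ereal (a + 1) < ereal ?L" using point_value_gt[OF a, of 1] by simp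
  also have "ereal ?L \<le> lagrange_const (cf_value (phi a (a + 1) (G_word 1)))"
    unfolding cf_value_phi_G_word
    by (rule lagrange_const_doubled_ge) (auto simp: mechanical_1)
  finally show "ereal (a + 1) < lagrange_const (cf_value (phi a (a + 1) (G_word 1)))" .
qed

section \<open>Comparing two slopes\<close>

text \<open>The words \<open>f1, f2\<close> are the right and left word of one slope, \<open>g1, g2\<close> those of another. The left
  words separate right after the common prefix \<open>h\<close>, and \<open>u\<close> cannot drop by twice as much as \<open>v\<close>.\<close>

lemma corner_less_if_left_words_separate:
  assumes pre: "\<And>i. i < k \<Longrightarrow> f1 i = h i" "\<And>i. i < k \<Longrightarrow> f2 i = h i"
      "\<And>i. i < k \<Longrightarrow> g1 i = h i" "\<And>i. i < k \<Longrightarrow> g2 i = h i"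
    and digit: "f2 k = 0" "g1 k \<noteq> 0" "g2 k \<noteq> 0"
  shows "corner_value a (doubled_cf a f1) (doubled_cf a f2) < corner_value a (doubled_cf a g1) (doubled_cf a g2)"
proof -
  let ?A = "real_of_int a"
  let ?W = "foldr pair_map (map (\<lambda>i. real_of_int (letter a (h i))) [0..<k])"
  have A: "2 \<le> ?A" using a by simp
  obtain K r where Kr: "0 < K" "0 \<le> r" "r \<le> 1"
    "\<And>s t. 0 \<le> s \<Longrightarrow> 0 \<le> t \<Longrightarrow> ?W s - ?W t = K * (s - t) / ((1 + r * s) * (1 + r * t))"
    using prefix_moebius[OF a, of h k] by metis
  have W: "doubled_cf a f = ?W (doubled_cf a (\<lambda>i. f (i + k)))" if "\<And>i. i < k \<Longrightarrow> f i = h i" for f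
    by (rule doubled_cf_common_prefix[OF a that])
  have main: "doubled_cf a f - doubled_cf a g1 < 2 * (doubled_cf a f2 - doubled_cf a g2)"
    if f: "\<And>i. i < k \<Longrightarrow> f i = h i" "f k = 0" for f
  proof -
    let ?s1 = "doubled_cf a (\<lambda>i. f (i + k))" and ?s2 = "doubled_cf a (\<lambda>i. f2 (i + k))"
    let ?t1 = "doubled_cf a (\<lambda>i. g1 (i + k))" and ?t2 = "doubled_cf a (\<lambda>i. g2 (i + k))"
    have "(?s1 - ?t1) / ((1 + r * ?s1) * (1 + r * ?t1)) < 2 * ((?s2 - ?t2) / ((1 + r * ?s2) * (1 + r * ?t2)))"
      using doubled_cf_zero_bounds[OF a, of "\<lambda>i. f (i + k)"] doubled_cf_zero_bounds[OF a, of "\<lambda>i. f2 (i + k)"]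
        doubled_cf_nonzero_bounds[OF a, of "\<lambda>i. g1 (i + k)"] doubled_cf_nonzero_bounds[OF a, of "\<lambda>i. g2 (i + k)"]
        f digit A Kr by (intro prefix_gap_ratio[of ?A]) auto
    from mult_strict_left_mono[OF this Kr(1)]
    have "K * (?s1 - ?t1) / ((1 + r * ?s1) * (1 + r * ?t1)) < 2 * (K * (?s2 - ?t2) / ((1 + r * ?s2) * (1 + r * ?t2)))"
      by (simp only: times_divide_eq_right mult.left_commute)
    then have "?W ?s1 - ?W ?t1 < 2 * (?W ?s2 - ?W ?t2)"
      by (simp only: Kr(4)[OF doubled_cf_bounds(1)[OF a] doubled_cf_bounds(1)[OF a]])
    then show ?thesis
      by (simp only: W[of f, OF f(1), symmetric] W[of f2, OF pre(2), symmetric]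
          W[of g1, OF pre(3), symmetric] W[of g2, OF pre(4), symmetric])
  qed
  have "doubled_cf a f1 - doubled_cf a g1 < 2 * (doubled_cf a f2 - doubled_cf a g2)"
  \<comment> \<open>If \<open>f1 k\<close> is nonzero, then \<open>u\<close> is even smaller than the value \<open>v\<close> of \<open>f2\<close>, so \<open>f2\<close> may replace \<open>f1\<close>.\<close>
  proof (cases "f1 k = 0")
    case True
    then show ?thesis using main[of f1] pre by simp
  next
    case False
    then have "doubled_cf a f1 < doubled_cf a f2"
      using doubled_cf_lex_less[OF a, of k f2 f1] pre digit by simp
    then show ?thesis using main[of f2] pre digit by simp
  qed
  moreover have "doubled_cf a g2 < doubled_cf a f2"
    using doubled_cf_lex_less[OF a, of k f2 g2] pre digit by simp
  ultimately have "pair_map ?A (doubled_cf a f1) - pair_map ?A (doubled_cf a g1)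
      < 1 / (?A + 1 + doubled_cf a g2) - 1 / (?A + 1 + doubled_cf a f2)"
    using A doubled_cf_bounds[OF a] by (intro corner_right_dominates) auto
  then show ?thesis by (simp add: corner_value_def)
qed

text \<open>Only the right words separate right after the prefix; the left words still agree there, and their
  values lie in the same short range, too short to make up for the gap between the right ones.\<close>

lemma corner_less_if_right_words_separate:
  assumes pre: "\<And>i. i < k \<Longrightarrow> f1 i = h i" "\<And>i. i < k \<Longrightarrow> f2 i = h i"
      "\<And>i. i < k \<Longrightarrow> g1 i = h i" "\<And>i. i < k \<Longrightarrow> g2 i = h i"
    and digit: "f1 k = 0" "f2 k = 0" "g1 k \<noteq> 0" "g2 k = 0"
  shows "corner_value a (doubled_cf a g1) (doubled_cf a g2) < corner_value a (doubled_cf a f1) (doubled_cf a f2)"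
proof -
  let ?A = "real_of_int a"
  let ?W = "foldr pair_map (map (\<lambda>i. real_of_int (letter a (h i))) [0..<k])"
  have A: "2 \<le> ?A" using a by simp
  obtain K r where Kr: "0 < K" "0 \<le> r" "r \<le> 1"
    "\<And>s t. 0 \<le> s \<Longrightarrow> 0 \<le> t \<Longrightarrow> ?W s - ?W t = K * (s - t) / ((1 + r * s) * (1 + r * t))"
    using prefix_moebius[OF a, of h k] by metis
  have W: "doubled_cf a f = ?W (doubled_cf a (\<lambda>i. f (i + k)))" if "\<And>i. i < k \<Longrightarrow> f i = h i" for f
    by (rule doubled_cf_common_prefix[OF a that])
  let ?s1 = "doubled_cf a (\<lambda>i. f1 (i + k))" and ?s2 = "doubled_cf a (\<lambda>i. f2 (i + k))"
  let ?t = "doubled_cf a (\<lambda>i. g1 (i + k))" and ?s = "doubled_cf a (\<lambda>i. g2 (i + k))"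
  have "(?s2 - ?s) / ((1 + r * ?s2) * (1 + r * ?s)) * (?A\<^sup>2 + 2)\<^sup>2
      < (?s1 - ?t) / ((1 + r * ?s1) * (1 + r * ?t)) * (?A + 1)\<^sup>2"
    using doubled_cf_zero_bounds[OF a, of "\<lambda>i. f1 (i + k)"] doubled_cf_zero_bounds[OF a, of "\<lambda>i. f2 (i + k)"]
      doubled_cf_nonzero_bounds[OF a, of "\<lambda>i. g1 (i + k)"] doubled_cf_zero_bounds[OF a, of "\<lambda>i. g2 (i + k)"]
      digit A Kr by (intro prefix_gap_dominates[of ?A]) auto
  from mult_strict_left_mono[OF this Kr(1)]
  have "K * (?s2 - ?s) / ((1 + r * ?s2) * (1 + r * ?s)) * (?A\<^sup>2 + 2)\<^sup>2
      < K * (?s1 - ?t) / ((1 + r * ?s1) * (1 + r * ?t)) * (?A + 1)\<^sup>2"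
    by simp
  then have "(?W ?s2 - ?W ?s) * (?A\<^sup>2 + 2)\<^sup>2 < (?W ?s1 - ?W ?t) * (?A + 1)\<^sup>2"
    by (simp only: Kr(4)[OF doubled_cf_bounds(1)[OF a] doubled_cf_bounds(1)[OF a]])
  then have "(doubled_cf a f2 - doubled_cf a g2) * (?A\<^sup>2 + 2)\<^sup>2 < (doubled_cf a f1 - doubled_cf a g1) * (?A + 1)\<^sup>2"
    by (simp only: W[of f1, OF pre(1), symmetric] W[of f2, OF pre(2), symmetric]
        W[of g1, OF pre(3), symmetric] W[of g2, OF pre(4), symmetric])
  moreover have "doubled_cf a g1 < doubled_cf a f1"
    using doubled_cf_lex_less[OF a, of k f1 g1] pre digit by simp
  ultimately have "1 / (?A + 1 + doubled_cf a g2) - 1 / (?A + 1 + doubled_cf a f2)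
      < pair_map ?A (doubled_cf a f1) - pair_map ?A (doubled_cf a g1)"
    using A doubled_cf_bounds[OF a] by (intro corner_left_dominates) auto
  then show ?thesis by (simp add: corner_value_def)
qed

end

lemma floor_between_integers:
  fixes t :: real
  assumes "real_of_int c < t" "t < real_of_int c + 1"
  shows "\<lfloor>t\<rfloor> = c" "\<lfloor>- t\<rfloor> = - c - 1"
  using assms by linarith+

text \<open>Since \<open>\<lceil>k x\<rceil> = \<lfloor>k x\<rfloor> + 1\<close> whenever \<open>k x\<close> is not an integer, the floors that build the right word
  and the ceilings that build the left word have the same differences.\<close>

lemma word_prefix:
  fixes x :: real
  assumes c: "\<And>k::nat. 1 \<le> k \<Longrightarrow> k < q \<Longrightarrow> real_of_int (c k) < k * x \<and> k * x < real_of_int (c k) + 1"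
    and i: "i + 2 < q"
  shows "right_word x i = c (i + 2) - c (i + 1)" "left_word x i = c (i + 2) - c (i + 1)"
proof -
  have b: "\<lfloor>real k * x\<rfloor> = c k" "\<lfloor>- (real k * x)\<rfloor> = - c k - 1" if "1 \<le> k" "k < q" for k
    using floor_between_integers[of "c k" "real k * x"] c[OF that] by auto
  show "right_word x i = c (i + 2) - c (i + 1)"
  proof -
    have e: "real_of_int (1 + int i + 1) * x = real (i + 2) * x"
      "real_of_int (1 + int i) * x = real (i + 1) * x"
      by (simp_all add: algebra_simps)
    show ?thesis
      unfolding right_word_def mechanical_def e using b(1)[of "i + 1"] b(1)[of "i + 2"] i by linarith
  qed
  show "left_word x i = c (i + 2) - c (i + 1)"
  proof -
    have e: "real_of_int (- 2 - int i + 1) * x = - (real (i + 1) * x)"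
      "real_of_int (- 2 - int i) * x = - (real (i + 2) * x)"
      by (simp_all add: algebra_simps)
    show ?thesis
      unfolding left_word_def mechanical_def e using b(2)[of "i + 1"] b(2)[of "i + 2"] i by linarith
  qed
qed

text \<open>The first letter that sees on which side of \<open>p/q\<close> the slope lies; at \<open>p/q\<close> itself floor and
  ceiling disagree about it.\<close>

lemma word_digit:
  fixes p :: int
  assumes q: "2 \<le> q" and c: "real_of_int (p - 1) < real (q - 1) * x" "real (q - 1) * x < p"
    and x: "0 < x" "x < 1"
  shows "right_word x (q - 2) = (if real q * x < p then 0 else 1)"
    "left_word x (q - 2) = (if real q * x \<le> p then 0 else 1)"
proof -
  have q1: "real q * x = real (q - 1) * x + x" using q by (simp add: of_nat_diff algebra_simps)
  have b: "\<lfloor>real (q - 1) * x\<rfloor> = p - 1" "\<lfloor>- (real (q - 1) * x)\<rfloor> = - p"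
    using floor_between_integers[of "p - 1" "real (q - 1) * x"] c by auto
  have "right_word x (q - 2) = \<lfloor>real q * x\<rfloor> - \<lfloor>real (q - 1) * x\<rfloor>"
    using q by (simp add: right_word_def mechanical_def of_nat_diff algebra_simps)
  also have "\<lfloor>real q * x\<rfloor> = (if real q * x < p then p - 1 else p)"
    using c x q1 by (auto simp: floor_eq_iff)
  finally show "right_word x (q - 2) = (if real q * x < p then 0 else 1)" using b by simp
  have "left_word x (q - 2) = \<lfloor>- (real (q - 1) * x)\<rfloor> - \<lfloor>- (real q * x)\<rfloor>"
    using q by (simp add: left_word_def mechanical_def of_nat_diff algebra_simps)
  also have "\<lfloor>- (real q * x)\<rfloor> = (if real q * x \<le> p then - p else - p - 1)"
    using c x q1 by (auto simp: floor_eq_iff)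
  finally show "left_word x (q - 2) = (if real q * x \<le> p then 0 else 1)" using b by simp
qed

text \<open>For \<open>k < q\<close> no integer lies between \<open>k x\<close> and \<open>k y\<close>, so \<open>c k\<close> is the integer part of both. The
  value at \<open>q - 1\<close> follows since \<open>(q - 1) x < p\<close> and \<open>(q - 1) y > p - 1\<close>.\<close>

lemma least_denominator_between:
  fixes x y :: real
  assumes x: "0 < x" "x \<in> \<rat>" and xy: "x < y" "y < 1"
  obtains p :: int and q :: nat and c :: "nat \<Rightarrow> int"
  where "2 \<le> q" "q * x \<le> p" "p \<le> q * y" "c (q - 1) = p - 1"
    "\<And>k. 1 \<le> k \<Longrightarrow> k < q \<Longrightarrow> real_of_int (c k) < k * x \<and> k * y < real_of_int (c k) + 1"
proof -
  let ?P = "\<lambda>q::nat. (1::nat) \<le> q \<and> (\<exists>p::int. real q * x \<le> real_of_int p \<and> real_of_int p \<le> real q * y)"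
  obtain p0 q0 where pq0: "0 < q0" "x = real_of_int p0 / real_of_int q0"
    using x(2) by (rule Rats_cases')
  have "real_of_int q0 * x \<le> real_of_int q0 * y" using pq0(1) xy by (intro mult_left_mono) auto
  moreover have "real_of_int q0 * x = real_of_int p0" using pq0 by simp
  ultimately have "?P (nat q0)" using pq0(1) by (auto intro!: exI[of _ p0])
  then have ex: "\<exists>q. ?P q" by blast
  define q where "q = (LEAST q. ?P q)"
  have q: "?P q" unfolding q_def using ex by (rule LeastI_ex)
  then obtain p :: int where p: "q * x \<le> p" "p \<le> q * y" by blast
  have least: "\<not> ?P k" if "k < q" for k using that unfolding q_def by (rule not_less_Least)
  define c where "c = (\<lambda>k::nat. \<lfloor>k * x\<rfloor>)"
  have c: "real_of_int (c k) < k * x \<and> k * y < real_of_int (c k) + 1" if k: "1 \<le> k" "k < q" for k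
  proof -
    have no: "\<not> (k * x \<le> m \<and> m \<le> k * y)" for m :: int using least[of k] k by blast
    have "k * x \<le> k * y" using xy by (intro mult_left_mono) auto
    moreover have "c k \<le> k * x" "k * x < real_of_int (c k) + 1" unfolding c_def by linarith+
    ultimately show ?thesis using no[of "c k"] no[of "c k + 1"] by fastforce
  qed
  have q2: "2 \<le> q"
  proof (rule ccontr)
    assume "\<not> 2 \<le> q"
    then have "q = 1" using q by linarith
    then have "0 < p" "p < 1" using p x xy by auto
    then show False by simp
  qed
  have "c (q - 1) = p - 1"
  proof -
    have r: "real (q - 1) = real q - 1" using q2 by (simp add: of_nat_diff)
    have "real_of_int (c (q - 1)) < (real q - 1) * x" "(real q - 1) * y < c (q - 1) + 1"
      using c[of "q - 1"] q2 unfolding r by auto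
    then have "real_of_int (c (q - 1)) < p" "real_of_int (p - 1) < c (q - 1) + 1"
      using p x xy by (auto simp: algebra_simps)
    then show ?thesis by linarith
  qed
  with that q2 p c show thesis by blast
qed

text \<open>With \<open>p/q\<close> the fraction of least denominator in \<open>[x, y]\<close>, the comparison has opposite outcomes
  according to whether \<open>p/q\<close> is the right end point.\<close>

lemma mechanical_corner_distinct:
  fixes a :: int
  assumes a: "2 \<le> a" and x: "0 < x" "x \<in> \<rat>" and xy: "x < y" "y < 1"
  shows "mechanical_corner a x \<noteq> mechanical_corner a y"
proof -
  obtain p :: int and q :: nat and c where
    q: "2 \<le> q" and p: "q * x \<le> p" "p \<le> q * y" and cq: "c (q - 1) = p - 1"
    and c: "\<And>k. 1 \<le> k \<Longrightarrow> k < q \<Longrightarrow> real_of_int (c k) < k * x \<and> k * y < real_of_int (c k) + 1"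
    using least_denominator_between[OF x xy] by metis
  have kxy: "real k * x \<le> real k * y" for k :: nat using xy by (intro mult_left_mono) auto
  have cx: "real_of_int (c k) < k * x \<and> k * x < real_of_int (c k) + 1"
    and cy: "real_of_int (c k) < k * y \<and> k * y < real_of_int (c k) + 1" if "1 \<le> k" "k < q" for k
    using c[OF that] kxy[of k] by linarith+
  define h where "h = (\<lambda>i. c (i + 2) - c (i + 1))"
  have pre: "right_word x i = h i" "left_word x i = h i" "right_word y i = h i" "left_word y i = h i"
    if "i < q - 2" for i
    using word_prefix[of q c x, OF cx] word_prefix[of q c y, OF cy] that unfolding h_def by auto
  have dx: "right_word x (q - 2) = (if real q * x < p then 0 else 1)"
      "left_word x (q - 2) = 0"
    using word_digit[OF q, of p x] cx[of "q - 1"] q cq x xy p by auto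
  have dy: "right_word y (q - 2) = 1"
      "left_word y (q - 2) = (if real q * y \<le> p then 0 else 1)"
    using word_digit[OF q, of p y] cy[of "q - 1"] q cq x xy p by auto
  show ?thesis
  proof (cases "real q * y \<le> p")
    case False
    then have "mechanical_corner a x < mechanical_corner a y"
      unfolding mechanical_corner_def
      using pre dx dy by (intro corner_less_if_left_words_separate[OF a, where k = "q - 2" and h = h]) auto
    then show ?thesis by simp
  next
    case True
    have "real q * x < real q * y" using xy q by simp
    then have "real q * x < p" using p True by linarith
    then have "mechanical_corner a y < mechanical_corner a x"
      unfolding mechanical_corner_def
      using pre dx dy True by (intro corner_less_if_right_words_separate[OF a, where k = "q - 2" and h = h]) auto
    then show ?thesis by simp
  qed
qed

text \<open>The constants of \<open>0\<close>, of \<open>1\<close>, and of all interior slopes are separated by the bounds \<open>a + 1\<close> and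
  \<open>a + 1 + 2/(a + 1)\<close>.\<close>

lemma lagrange_const_G_word_distinct:
  fixes a :: int
  assumes a: "2 \<le> a" and x: "x \<in> \<rat>" "0 \<le> x" and y: "y \<in> \<rat>" "y \<le> 1" and xy: "x < y"
  shows "lagrange_const (cf_value (phi a (a + 1) (G_word x)))
    \<noteq> lagrange_const (cf_value (phi a (a + 1) (G_word y)))"
proof -
  let ?L = "\<lambda>x. lagrange_const (cf_value (phi a (a + 1) (G_word x)))"
  have "ereal (a + 1) < ereal (a + 1 + 2 / (real_of_int a + 1))" using a by simp
  note endpoint = this lagrange_const_G_word_0[OF a] lagrange_const_G_word_1[OF a]
  consider "x = 0" "y = 1" | "x = 0" "y < 1" | "0 < x" "y = 1" | "0 < x" "y < 1"
    using x y by linarith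
  then show ?thesis
  proof cases
    case 1
    then show ?thesis using endpoint by auto
  next
    case 2
    then have "ereal (a + 1 + 2 / (real_of_int a + 1)) < ?L y"
      using lagrange_const_G_word_gt[OF a, of y] y xy by simp
    then have "?L 0 < ?L y" using endpoint by (meson le_less_trans less_trans)
    then show ?thesis using 2 by simp
  next
    case 3
    then have "ereal (a + 1 + 2 / (real_of_int a + 1)) < ?L x"
      using lagrange_const_G_word_gt[OF a, of x] x xy by simp
    then have "?L 1 < ?L x" using endpoint by (meson le_less_trans)
    then show ?thesis using 3 by simp
  next
    case 4
    then show ?thesis
      using lagrange_const_G_word[OF a, of x] lagrange_const_G_word[OF a, of y]
        mechanical_corner_distinct[OF a _ x(1) xy] x y xy by simp
  qed
qed

theorem theorem1p3:
  fixes a b :: int and x y :: real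
  assumes "a > 1" and "b = a + 1"
    and "x \<in> \<rat>" and "0 \<le> x" and "x \<le> 1"
    and "y \<in> \<rat>" and "0 \<le> y" and "y \<le> 1"
    and "lagrange_const (cf_value (phi a b (G_word x)))
       = lagrange_const (cf_value (phi a b (G_word y)))"
  shows "x = y"
  using lagrange_const_G_word_distinct[of a x y] lagrange_const_G_word_distinct[of a y x] assms
  by (cases x y rule: linorder_cases) auto

end
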